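(* Let $\alpha$ be an ordinal. If $x=(A,B)\in\overline{\mathbb{R}}_\alpha$ is a proper Dedekind cut, then $x+(-x)=0$, where $0$ denotes the zero cut.
   Context: For an ordinal $\alpha$, let $\mathbb{N}_\alpha$ be the set of ordinals strictly less than $\omega^{\omega^\alpha}$ with the ordinal order and the natural (Hessenberg) sum and product. Let $\mathbb{Z}_\alpha$ be the classes of pairs $(a,b)\in\mathbb{N}_\alpha^2$ under $(a,b)\sim(c,d)\iff a+d=b+c$, with $(a,b)+(c,d)=(a+c,b+d)$, $(a,b)(c,d)=(ac+bd,ad+bc)$, order $[(a_1,a_2)]\ge[(b_1,b_2)]\iff a_1+b_2\ge a_2+b_1$. Let $\mathbb{Q}_\alpha$ be its field of fractions (classes of $(a,b)$, $b\ne0$, under $ad=bc$, usual fraction operations), a linearly ordered field with $A\ge0$ iff $ab\ge0$ for representatives and $A\ge B$ iff $A-B\ge0$; $\mathbb{Q}_\alpha^+$ denotes its positive elements. A Dedekind cut on $\mathbb{Q}_\alpha$ is a pair $(A,B)$ of subsets such that: every element of $A$ is less than every element of $B$; $\mathbb{Q}_\alpha\setminus(A\cup B)$ has at most one element; $\inf(B)\notin B$ and $\sup(A)\notin A$; $A\cap B=\varnothing$. $\overline{\mathbb{R}}_\alpha$ is the set of all Dedekind cuts on $\mathbb{Q}_\alpha$. A ball in $\mathbb{Q}_\alpha$ is $\{y: |x-y|<r\}$ with $x\in\mathbb{Q}_\alpha$, $r\in\mathbb{Q}_\alpha^+$. A cut $(A,B)$ is improper if there exists $d\in\mathbb{Q}_\alpha^+$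 such that every ball $U$ meeting both $A$ and $B$ satisfies $\sup(U)-\inf(U)>d$; otherwise proper. Sum: $(A,B)+(C,D)=(A+C,B+D)$ with Minkowski sums $X+Y=\{x+y:x\in X,y\in Y\}$. Opposite cut: $-(A,B)=(E,F)$ with $E=\{-y: y\in B\}$, $F=\{-y: y\in A\}$. The zero cut is $(\{q\in\mathbb{Q}_\alpha: q<0\},\{q\in\mathbb{Q}_\alpha: q>0\})$. *)

theory Defs
  imports Main
begin

section \<open>Ordinals\<close>

text \<open>
  HOL has no type of all ordinals.  We use the isomorphism classes of well-orders on
  subsets of \<^typ>\<open>'a + nat\<close>, i.e. the ordinals of cardinality at most that of
  \<^typ>\<open>'a + nat\<close>.  Since \<^typ>\<open>'a\<close> is arbitrary, every ordinal occurs for a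
  suitable \<^typ>\<open>'a\<close>.  As \<^typ>\<open>'a + nat\<close> is infinite, every set of
  such ordinals of at most that cardinality is bounded (the order type of the
  whole is a successor cardinal), so all the minima \<open>LEAST\<close> below exist and
  the operations are those of set theory; in particular \<open>\<omega> ^ \<omega> ^ \<alpha>\<close> lies in the same type as \<open>\<alpha>\<close>.
\<close>

quotient_type 'a ordinal = "('a + nat) rel" / partial: "\<lambda>r s. (r, s) \<in> ordIso"
proof (rule part_equivpI)
  show "\<exists>r :: ('a + nat) rel. (r, r) \<in> ordIso"
    by (rule exI[of _ "{}"]) (simp add: ordIso_reflexive)
  show "symp (\<lambda>r s. (r :: ('a + nat) rel, s) \<in> ordIso)"
    by (auto intro!: sympI ordIso_symmetric)
  show "transp (\<lambda>r s. (r :: ('a + nat) rel, s) \<in> ordIso)"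
    by (auto intro!: transpI elim: ordIso_transitive)
qed

instantiation ordinal :: (type) wellorder
begin

lift_definition less_eq_ordinal :: "'a ordinal \<Rightarrow> 'a ordinal \<Rightarrow> bool"
  is "\<lambda>r s. (r, s) \<in> ordLeq"
  by (meson ordIso_iff_ordLeq ordLeq_transitive)

lift_definition less_ordinal :: "'a ordinal \<Rightarrow> 'a ordinal \<Rightarrow> bool"
  is "\<lambda>r s. (r, s) \<in> ordLess"
  by (meson ordIso_iff_ordLeq ordLess_ordLeq_trans ordLeq_ordLess_trans)

instance
proof
  fix x y z :: "'a ordinal"
  note ordIso_iff_ordLeq [simp]
  show "x < y \<longleftrightarrow> x \<le> y \<and> \<not> y \<le> x"
    by transfer (meson not_ordLess_ordLeq not_ordLeq_iff_ordLess ordLeq_Well_order_simp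
        ordLess_imp_ordLeq ordIso_iff_ordLeq)
  show "x \<le> x"
    by transfer simp
  show "x \<le> y \<Longrightarrow> y \<le> z \<Longrightarrow> x \<le> z"
    by transfer (rule ordLeq_transitive)
  show "x \<le> y \<Longrightarrow> y \<le> x \<Longrightarrow> x = y"
    by transfer simp
  show "x \<le> y \<or> y \<le> x"
    by transfer (meson ordIso_iff_ordLeq ordLeq_Well_order_simp ordLeq_total)
next
  fix P :: "'a ordinal \<Rightarrow> bool" and a
  assume step: "\<And>x. (\<And>y. y < x \<Longrightarrow> P y) \<Longrightarrow> P x"
  have "wf (inv_image ordLess (rep_ordinal :: 'a ordinal \<Rightarrow> _))"
    by (intro wf_inv_image wf_ordLess)
  then show "P a"
    by (induction a rule: wf_induct_rule) (auto intro: step simp: less_ordinal_def)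
qed

end

definition ord_zero :: "'a ordinal" where
  "ord_zero = (LEAST c. True)"

definition ord_one :: "'a ordinal" where
  "ord_one = (LEAST c. ord_zero < c)"

definition ord_omega :: "'a ordinal" where
  "ord_omega = (LEAST c. infinite {..<c})"

text \<open>
  The ordinary ordinal sum and product, and \<open>b \<mapsto> \<omega> ^ b\<close>; the recursions cover the
  zero, successor and limit case at once.
\<close>

function ord_add :: "'a ordinal \<Rightarrow> 'a ordinal \<Rightarrow> 'a ordinal" where
  "ord_add a b = (LEAST c. a \<le> c \<and> (\<forall>b'<b. ord_add a b' < c))"
  by pat_completeness auto
termination
  by (relation "inv_image {(x, y). x < y} snd", rule wf_inv_image[OF wf], simp)

declare ord_add.simps [simp del]

function ord_mult :: "'a ordinal \<Rightarrow> 'a ordinal \<Rightarrow> 'a ordinal" where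
  "ord_mult a b = (LEAST c. \<forall>b'<b. ord_add (ord_mult a b') a \<le> c)"
  by pat_completeness auto
termination
  by (relation "inv_image {(x, y). x < y} snd", rule wf_inv_image[OF wf], simp)

declare ord_mult.simps [simp del]

function omega_pow :: "'a ordinal \<Rightarrow> 'a ordinal" where
  "omega_pow b = (LEAST c. ord_one \<le> c \<and> (\<forall>b'<b. ord_mult (omega_pow b') ord_omega \<le> c))"
  by pat_completeness auto
termination
  by (relation "{(x, y). x < y}", rule wf, simp)

declare omega_pow.simps [simp del]

text \<open>
  The natural (Hessenberg) sum and product, by the standard simultaneous recursions.
\<close>

function nat_add :: "'a ordinal \<Rightarrow> 'a ordinal \<Rightarrow> 'a ordinal"  (infixl "+\<^sub>H" 65) where
  "a +\<^sub>H b = (LEAST c. (\<forall>a'<a. a' +\<^sub>H b < c) \<and> (\<forall>b'<b. a +\<^sub>H b' < c))"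
  by pat_completeness auto
termination
  by (relation "{(x, y). x < y} <*lex*> {(x, y). x < y}", rule wf_lex_prod[OF wf wf], simp_all)

declare nat_add.simps [simp del]

function nat_mult :: "'a ordinal \<Rightarrow> 'a ordinal \<Rightarrow> 'a ordinal"  (infixl "*\<^sub>H" 70) where
  "a *\<^sub>H b =
     (LEAST c. \<forall>a'<a. \<forall>b'<b. (a' *\<^sub>H b) +\<^sub>H (a *\<^sub>H b') < c +\<^sub>H (a' *\<^sub>H b'))"
  by pat_completeness auto
termination
  by (relation "{(x, y). x < y} <*lex*> {(x, y). x < y}", rule wf_lex_prod[OF wf wf], simp_all)

declare nat_mult.simps [simp del]

definition NN :: "'a ordinal \<Rightarrow> 'a ordinal set" where
  "NN \<alpha> = {..<omega_pow (omega_pow \<alpha>)}"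


section \<open>The ring of differences\<close>

type_synonym 'a zz = "('a ordinal \<times> 'a ordinal) set"

definition ZZ_rel :: "'a ordinal \<Rightarrow> ('a ordinal \<times> 'a ordinal) rel" where
  "ZZ_rel \<alpha> = {((a, b), (c, d)) | a b c d.
     a \<in> NN \<alpha> \<and> b \<in> NN \<alpha> \<and> c \<in> NN \<alpha> \<and> d \<in> NN \<alpha> \<and> a +\<^sub>H d = b +\<^sub>H c}"

definition ZZ :: "'a ordinal \<Rightarrow> 'a zz set" where
  "ZZ \<alpha> = (NN \<alpha> \<times> NN \<alpha>) // ZZ_rel \<alpha>"

definition ZZ_class :: "'a ordinal \<Rightarrow> 'a ordinal \<Rightarrow> 'a ordinal \<Rightarrow> 'a zz" where
  "ZZ_class \<alpha> a b = ZZ_rel \<alpha> `` {(a, b)}"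

definition ZZ_zero :: "'a ordinal \<Rightarrow> 'a zz" where
  "ZZ_zero \<alpha> = ZZ_class \<alpha> ord_zero ord_zero"

definition ZZ_one :: "'a ordinal \<Rightarrow> 'a zz" where
  "ZZ_one \<alpha> = ZZ_class \<alpha> ord_one ord_zero"

definition ZZ_add :: "'a ordinal \<Rightarrow> 'a zz \<Rightarrow> 'a zz \<Rightarrow> 'a zz" where
  "ZZ_add \<alpha> X Y = (\<Union>(a, b)\<in>X. \<Union>(c, d)\<in>Y. ZZ_class \<alpha> (a +\<^sub>H c) (b +\<^sub>H d))"

definition ZZ_uminus :: "'a ordinal \<Rightarrow> 'a zz \<Rightarrow> 'a zz" where
  "ZZ_uminus \<alpha> X = (\<Union>(a, b)\<in>X. ZZ_class \<alpha> b a)"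

definition ZZ_mult :: "'a ordinal \<Rightarrow> 'a zz \<Rightarrow> 'a zz \<Rightarrow> 'a zz" where
  "ZZ_mult \<alpha> X Y = (\<Union>(a, b)\<in>X. \<Union>(c, d)\<in>Y.
     ZZ_class \<alpha> (a *\<^sub>H c +\<^sub>H b *\<^sub>H d) (a *\<^sub>H d +\<^sub>H b *\<^sub>H c))"

definition ZZ_le :: "'a zz \<Rightarrow> 'a zz \<Rightarrow> bool" where
  "ZZ_le Y X \<longleftrightarrow> (\<exists>(a1, a2)\<in>X. \<exists>(b1, b2)\<in>Y. a1 +\<^sub>H b2 \<ge> a2 +\<^sub>H b1)"


section \<open>The field of fractions\<close>

type_synonym 'a qq = "('a zz \<times> 'a zz) set"

definition QQ_rel :: "'a ordinal \<Rightarrow> ('a zz \<times> 'a zz) rel" where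
  "QQ_rel \<alpha> = {((a, b), (c, d)) | a b c d.
     a \<in> ZZ \<alpha> \<and> b \<in> ZZ \<alpha> - {ZZ_zero \<alpha>} \<and> c \<in> ZZ \<alpha> \<and> d \<in> ZZ \<alpha> - {ZZ_zero \<alpha>} \<and>
     ZZ_mult \<alpha> a d = ZZ_mult \<alpha> b c}"

definition QQ :: "'a ordinal \<Rightarrow> 'a qq set" where
  "QQ \<alpha> = (ZZ \<alpha> \<times> (ZZ \<alpha> - {ZZ_zero \<alpha>})) // QQ_rel \<alpha>"

definition QQ_class :: "'a ordinal \<Rightarrow> 'a zz \<Rightarrow> 'a zz \<Rightarrow> 'a qq" where
  "QQ_class \<alpha> a b = QQ_rel \<alpha> `` {(a, b)}"

definition QQ_zero :: "'a ordinal \<Rightarrow> 'a qq" where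
  "QQ_zero \<alpha> = QQ_class \<alpha> (ZZ_zero \<alpha>) (ZZ_one \<alpha>)"

definition QQ_add :: "'a ordinal \<Rightarrow> 'a qq \<Rightarrow> 'a qq \<Rightarrow> 'a qq" where
  "QQ_add \<alpha> X Y = (\<Union>(a, b)\<in>X. \<Union>(c, d)\<in>Y.
     QQ_class \<alpha> (ZZ_add \<alpha> (ZZ_mult \<alpha> a d) (ZZ_mult \<alpha> b c)) (ZZ_mult \<alpha> b d))"

definition QQ_uminus :: "'a ordinal \<Rightarrow> 'a qq \<Rightarrow> 'a qq" where
  "QQ_uminus \<alpha> X = (\<Union>(a, b)\<in>X. QQ_class \<alpha> (ZZ_uminus \<alpha> a) b)"

definition QQ_mult :: "'a ordinal \<Rightarrow> 'a qq \<Rightarrow> 'a qq \<Rightarrow> 'a qq" where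
  "QQ_mult \<alpha> X Y = (\<Union>(a, b)\<in>X. \<Union>(c, d)\<in>Y.
     QQ_class \<alpha> (ZZ_mult \<alpha> a c) (ZZ_mult \<alpha> b d))"

definition QQ_minus :: "'a ordinal \<Rightarrow> 'a qq \<Rightarrow> 'a qq \<Rightarrow> 'a qq" where
  "QQ_minus \<alpha> X Y = QQ_add \<alpha> X (QQ_uminus \<alpha> Y)"

definition QQ_nonneg :: "'a ordinal \<Rightarrow> 'a qq \<Rightarrow> bool" where
  "QQ_nonneg \<alpha> X \<longleftrightarrow> (\<exists>(a, b)\<in>X. ZZ_le (ZZ_zero \<alpha>) (ZZ_mult \<alpha> a b))"

definition QQ_le :: "'a ordinal \<Rightarrow> 'a qq \<Rightarrow> 'a qq \<Rightarrow> bool" where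
  "QQ_le \<alpha> Y X \<longleftrightarrow> QQ_nonneg \<alpha> (QQ_minus \<alpha> X Y)"

definition QQ_less :: "'a ordinal \<Rightarrow> 'a qq \<Rightarrow> 'a qq \<Rightarrow> bool" where
  "QQ_less \<alpha> X Y \<longleftrightarrow> QQ_le \<alpha> X Y \<and> X \<noteq> Y"

definition QQ_pos :: "'a ordinal \<Rightarrow> 'a qq set" where
  "QQ_pos \<alpha> = {q \<in> QQ \<alpha>. QQ_less \<alpha> (QQ_zero \<alpha>) q}"

definition QQ_abs :: "'a ordinal \<Rightarrow> 'a qq \<Rightarrow> 'a qq" where
  "QQ_abs \<alpha> X = (if QQ_le \<alpha> (QQ_zero \<alpha>) X then X else QQ_uminus \<alpha> X)"

text \<open>
  Suprema and infima need not exist in the field, hence they are relations.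
\<close>

definition is_sup :: "'a ordinal \<Rightarrow> 'a qq set \<Rightarrow> 'a qq \<Rightarrow> bool" where
  "is_sup \<alpha> S s \<longleftrightarrow> s \<in> QQ \<alpha> \<and> (\<forall>y\<in>S. QQ_le \<alpha> y s) \<and>
     (\<forall>u\<in>QQ \<alpha>. (\<forall>y\<in>S. QQ_le \<alpha> y u) \<longrightarrow> QQ_le \<alpha> s u)"

definition is_inf :: "'a ordinal \<Rightarrow> 'a qq set \<Rightarrow> 'a qq \<Rightarrow> bool" where
  "is_inf \<alpha> S i \<longleftrightarrow> i \<in> QQ \<alpha> \<and> (\<forall>y\<in>S. QQ_le \<alpha> i y) \<and>
     (\<forall>l\<in>QQ \<alpha>. (\<forall>y\<in>S. QQ_le \<alpha> l y) \<longrightarrow> QQ_le \<alpha> l i)"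

definition QQ_ball :: "'a ordinal \<Rightarrow> 'a qq \<Rightarrow> 'a qq \<Rightarrow> 'a qq set" where
  "QQ_ball \<alpha> x r = {y \<in> QQ \<alpha>. QQ_less \<alpha> (QQ_abs \<alpha> (QQ_minus \<alpha> x y)) r}"

definition QQ_balls :: "'a ordinal \<Rightarrow> 'a qq set set" where
  "QQ_balls \<alpha> = {QQ_ball \<alpha> x r | x r. x \<in> QQ \<alpha> \<and> r \<in> QQ_pos \<alpha>}"


section \<open>Dedekind cuts\<close>

type_synonym 'a cut = "'a qq set \<times> 'a qq set"

text \<open>
  One of the two sets may be empty; such a cut is improper, because no ball meets both sets.
  ``At most one element'' must not be expressed by \<open>card \<dots> \<le> 1\<close>, which also holds for
  infinite sets.
\<close>

definition cuts :: "'a ordinal \<Rightarrow> 'a cut set" where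
  "cuts \<alpha> = {(A, B). A \<subseteq> QQ \<alpha> \<and> B \<subseteq> QQ \<alpha> \<and>
     (\<forall>a\<in>A. \<forall>b\<in>B. QQ_less \<alpha> a b) \<and>
     (\<forall>p\<in>QQ \<alpha> - (A \<union> B). \<forall>q\<in>QQ \<alpha> - (A \<union> B). p = q) \<and>
     (\<forall>i. is_inf \<alpha> B i \<longrightarrow> i \<notin> B) \<and> (\<forall>s. is_sup \<alpha> A s \<longrightarrow> s \<notin> A) \<and>
     A \<inter> B = {}}"

text \<open>
  A ball \<open>U\<close> with centre \<open>x\<close> and radius \<open>r\<close> has supremum \<open>x + r\<close> and infimum \<open>x - r\<close>, so
  the inner existential quantifiers just name them.
\<close>

definition improper_cut :: "'a ordinal \<Rightarrow> 'a cut \<Rightarrow> bool" where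
  "improper_cut \<alpha> = (\<lambda>(A, B). \<exists>d\<in>QQ_pos \<alpha>. \<forall>U\<in>QQ_balls \<alpha>.
     U \<inter> A \<noteq> {} \<and> U \<inter> B \<noteq> {} \<longrightarrow>
     (\<exists>s i. is_sup \<alpha> U s \<and> is_inf \<alpha> U i \<and> QQ_less \<alpha> d (QQ_minus \<alpha> s i)))"

definition minkowski_sum :: "'a ordinal \<Rightarrow> 'a qq set \<Rightarrow> 'a qq set \<Rightarrow> 'a qq set" where
  "minkowski_sum \<alpha> X Y = {QQ_add \<alpha> x y | x y. x \<in> X \<and> y \<in> Y}"

definition cut_add :: "'a ordinal \<Rightarrow> 'a cut \<Rightarrow> 'a cut \<Rightarrow> 'a cut" where
  "cut_add \<alpha> = (\<lambda>(A, B) (C, D). (minkowski_sum \<alpha> A C, minkowski_sum \<alpha> B D))"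

definition cut_uminus :: "'a ordinal \<Rightarrow> 'a cut \<Rightarrow> 'a cut" where
  "cut_uminus \<alpha> = (\<lambda>(A, B). (QQ_uminus \<alpha> ` B, QQ_uminus \<alpha> ` A))"

definition cut_zero :: "'a ordinal \<Rightarrow> 'a cut" where
  "cut_zero \<alpha> = ({q \<in> QQ \<alpha>. QQ_less \<alpha> q (QQ_zero \<alpha>)}, {q \<in> QQ \<alpha>. QQ_less \<alpha> (QQ_zero \<alpha>) q})"

end

(*
  The Hessenberg operations make the ordinals of the type an ordered cancellative commutative
  semiring, and the ordinals below omega ^ omega ^ alpha a subsemiring. So the ring of the paper is
  a subring of the ring of formal differences of all ordinals, and its field is a subfield of the
  ordered field of fractions of that ring. There, properness gives a in A and b in B
  arbitrarily close to each other. Translating such a pair, and using that the cut misses at most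
  one point, one obtains a in A and b in B at any prescribed distance d > 0.
*)

theory Submission
  imports Defs "HOL-Computational_Algebra.Fraction_Field"
begin

text \<open>Each ordinal operation is a \<open>LEAST\<close>, which says nothing unless a candidate
  exists; boundedness of small sets therefore has to be settled before any arithmetic. After that,
  the recursive operations are used through a description of their upper bounds: a value is at most
  \<open>c\<close> iff the recursive conditions hold for \<open>c\<close>. Two expressions are equal
  once they have the same upper bounds.

  Differences and fractions are formed over all ordinals because a type, and hence a class instance
  such as \<open>linordered_idom\<close>, cannot depend on \<open>\<alpha>\<close>. What depends on
  \<open>\<alpha>\<close> are the carriers \<open>ZR \<alpha>\<close> and \<open>QR \<alpha>\<close>
  and the maps \<open>zcls \<alpha>\<close> and \<open>qcls \<alpha>\<close>, which translate them
  into the given quotient sets. The obstacle is closure of \<open>NN \<alpha>\<close>: its bound is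
  built from the ordinary sum and product, the ring from the natural ones, and the two have to be
  compared on finite multiples of powers of omega.

  An exact distance matters because the sum of a cut and its opposite consists of the differences
  between the two sides, and equality with the zero cut demands every nonzero element as such a
  difference.\<close>

unbundle cardinal_syntax


section \<open>Boundedness of small sets of ordinals\<close>

lemma abs_ordinal_rep [simp]: "abs_ordinal (rep_ordinal c) = c"
  by (rule Quotient3_abs_rep[OF Quotient3_ordinal])

lemma rep_ordinal_Well_order: "Well_order (rep_ordinal c)"
proof -
  have "(rep_ordinal c, rep_ordinal c) \<in> ordIso"
    by (rule Quotient3_rep_reflp[OF Quotient3_ordinal])
  then show ?thesis
    by (simp add: ordIso_def)
qed

lemma abs_ordinal_eqI: "(r, s) \<in> ordIso \<Longrightarrow> abs_ordinal r = abs_ordinal s"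
  using Quotient3_rel[OF Quotient3_ordinal] by blast

lemma abs_ordinal_less_iff:
  assumes "Well_order r" "Well_order s"
  shows "abs_ordinal r < abs_ordinal s \<longleftrightarrow> (r, s) \<in> ordLess"
  using assms by (intro less_ordinal.abs_eq) (simp_all add: ordIso_reflexive)

lemma less_ordinal_rep_iff: "x < y \<longleftrightarrow> (rep_ordinal x, rep_ordinal y) \<in> ordLess"
  using abs_ordinal_less_iff[OF rep_ordinal_Well_order rep_ordinal_Well_order, of x y] by simp

text \<open>The ordinals below \<open>c\<close> are order types of proper initial segments of a
  fixed well-order representing \<open>c\<close>, so the points of \<open>'a + nat\<close> suffice
  to index them.\<close>

lemma card_lessThan_ordinal:
  fixes c :: "'a ordinal"
  shows "|{..<c}| \<le>o |UNIV :: ('a + nat) set|"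
proof -
  let ?r = "rep_ordinal c"
  let ?f = "\<lambda>x. abs_ordinal (Restr ?r (underS ?r x))"
  have "{..<c} \<subseteq> ?f ` UNIV"
  proof
    fix d assume "d \<in> {..<c}"
    then have "(rep_ordinal d, ?r) \<in> ordLess"
      by (simp add: less_ordinal_rep_iff)
    then obtain x where "(rep_ordinal d, Restr ?r (underS ?r x)) \<in> ordIso"
      using ordLess_iff_ordIso_Restr[OF rep_ordinal_Well_order rep_ordinal_Well_order] by blast
    from abs_ordinal_eqI[OF this] show "d \<in> ?f ` UNIV"
      by simp
  qed
  then show ?thesis
    by (rule ordLeq_transitive[OF card_of_mono1 card_of_image])
qed

text \<open>The Burali-Forti argument: an injection \<open>f\<close> into \<open>'a + nat\<close>
  would transport the order of all ordinals to a well-order \<open>r\<close> whose type is itself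
  one of the ordinals. Each ordinal \<open>d\<close> is at most the type of the segment of
  \<open>r\<close> below \<open>f d\<close>; with the type of \<open>r\<close> for \<open>d\<close>,
  the order \<open>r\<close> would be no longer than one of its own proper segments.\<close>

lemma ordinal_not_small: "\<not> |UNIV :: 'a ordinal set| \<le>o |UNIV :: ('a + nat) set|"
proof
  assume "|UNIV :: 'a ordinal set| \<le>o |UNIV :: ('a + nat) set|"
  then obtain f :: "'a ordinal \<Rightarrow> 'a + nat" where f: "inj f"
    using card_of_ordLeq[of "UNIV :: 'a ordinal set" "UNIV :: ('a + nat) set"] by auto
  define w :: "'a ordinal rel" where "w = {(x, y). x \<le> y}"
  define r where "r = dir_image w f"
  have Fw: "Field w = UNIV"
    by (auto simp: w_def Field_def)
  have "w - Id = {(x, y). x < y}"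
    by (auto simp: w_def)
  then have "wf (w - Id)"
    using wf by metis
  moreover have "refl_on UNIV w" "trans w" "antisym w" "total_on UNIV w"
    by (auto simp: w_def refl_on_def trans_def antisym_def total_on_def)
  ultimately have "Well_order w"
    unfolding order_on_defs Fw by simp
  then have r: "Well_order r"
    unfolding r_def using f inj_on_subset by (intro Well_order_dir_image) blast+
  have r_iff: "(f x, f y) \<in> r \<longleftrightarrow> x \<le> y" for x y
    using f by (auto simp: r_def dir_image_def w_def inj_eq)
  let ?seg = "\<lambda>d. Restr r (underS r (f d))"
  have Wseg: "Well_order (?seg d)" for d
    using r by (rule Well_order_Restr)
  have Fr: "f x \<in> Field r" for x
    using r_iff[of x x] by (auto simp: Field_def)
  have seg_less: "abs_ordinal (?seg e) < abs_ordinal (?seg d)" if "e < d" for e d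
  proof -
    have "e \<le> d" and ne: "f e \<noteq> f d"
      using that f by (auto simp: inj_eq)
    then have ed: "f e \<in> underS r (f d)"
      by (auto simp: underS_def r_iff)
    have sub: "underS r (f e) \<subset> underS r (f d)"
    proof -
      have "underS r (f e) \<subseteq> underS r (f d)"
        using r \<open>e \<le> d\<close> by (intro underS_incr) (simp_all add: order_on_defs r_iff)
      moreover have "f e \<notin> underS r (f e)"
        by (auto simp: underS_def)
      ultimately show ?thesis
        using ed by blast
    qed
    have "wo_rel r"
      using r by (simp add: wo_rel_def)
    then have "(?seg e, ?seg d) \<in> ordLess"
      using ofilter_subset_ordLess[OF r wo_rel.underS_ofilter wo_rel.underS_ofilter] sub by simp
    then show ?thesis
      by (simp only: abs_ordinal_less_iff[OF Wseg Wseg])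
  qed
  \<comment> \<open>A strictly increasing map of a well-order into itself never drops below the
    identity: at a least point where it did, its value would be a smaller such point.\<close>
  have le: "d \<le> abs_ordinal (?seg d)" for d
  proof (induction d rule: less_induct)
    case (less d)
    show ?case
    proof (rule ccontr)
      assume "\<not> d \<le> abs_ordinal (?seg d)"
      then have *: "abs_ordinal (?seg d) < d"
        by simp
      from less[OF *] seg_less[OF *] show False
        by simp
    qed
  qed
  have "abs_ordinal (?seg (abs_ordinal r)) < abs_ordinal r"
    unfolding abs_ordinal_less_iff[OF Wseg r]
    by (rule underS_Restr_ordLess[OF r]) (use Fr in blast)
  with le[of "abs_ordinal r"] show False
    by simp
qed

text \<open>Regularity of a successor cardinal: if \<open>X\<close> were unbounded, the segments
  \<open>{..x}\<close> with \<open>x\<close> in \<open>X\<close> would cover the whole type. Such a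
  union of few small sets is small because \<open>'a + nat\<close> is infinite, which the summand
  \<open>nat\<close> guarantees.\<close>

lemma small_bounded:
  fixes X :: "'a ordinal set"
  assumes "|X| \<le>o |UNIV :: ('a + nat) set|"
  shows "\<exists>c. \<forall>x\<in>X. x < c"
proof (rule ccontr)
  assume "\<not> ?thesis"
  then have unb: "\<exists>x\<in>X. c \<le> x" for c
    by (meson not_le)
  have inf: "infinite (UNIV :: ('a + nat) set)"
    by (simp add: finite_Plus_UNIV_iff)
  have "|{x} \<union> {..<x}| \<le>o |UNIV :: ('a + nat) set|" for x :: "'a ordinal"
    using inf by (intro card_of_Un_ordLeq_infinite_Field card_lessThan_ordinal card_of_singl_ordLeq
        card_of_Card_order) (simp_all add: Field_card_of)
  moreover have "{x} \<union> {..<x} = {..x}" for x :: "'a ordinal"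
    by auto
  ultimately have "|{..x}| \<le>o |UNIV :: ('a + nat) set|" for x :: "'a ordinal"
    by metis
  with assms inf have "|\<Union>x\<in>X. {..x}| \<le>o |UNIV :: ('a + nat) set|"
    by (intro card_of_UNION_ordLeq_infinite) auto
  moreover have "(\<Union>x\<in>X. {..x}) = UNIV"
    using unb by auto
  ultimately show False
    using ordinal_not_small by metis
qed

lemma small_image_bounded:
  fixes f :: "'b \<Rightarrow> 'a ordinal"
  assumes "|I| \<le>o |UNIV :: ('a + nat) set|"
  shows "\<exists>c. \<forall>i\<in>I. f i < c"
proof -
  have "|f ` I| \<le>o |UNIV :: ('a + nat) set|"
    by (rule ordLeq_transitive[OF card_of_image assms])
  from small_bounded[OF this] show ?thesis
    by blast
qed

lemma lessThan_image_bounded: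
  fixes f :: "'a ordinal \<Rightarrow> 'a ordinal"
  shows "\<exists>c. \<forall>x<a. f x < c"
  using small_image_bounded[OF card_lessThan_ordinal[of a], of f] by (simp add: Ball_def)

lemma lessThan_image_bounded2:
  fixes f :: "'a ordinal \<Rightarrow> 'a ordinal \<Rightarrow> 'a ordinal"
  shows "\<exists>c. \<forall>x<a. \<forall>y<b. f x y < c"
proof -
  have "\<forall>x. \<exists>c. \<forall>y<b. f x y < c"
    using lessThan_image_bounded by blast
  then obtain g where g: "\<And>x y. y < b \<Longrightarrow> f x y < g x"
    by metis
  obtain c where "\<forall>x<a. g x < c"
    using lessThan_image_bounded by blast
  with g show ?thesis
    by (meson less_trans)
qed


section \<open>The semiring of ordinals under the Hessenberg operations\<close>

lemma ordinal_gt_ex: "\<exists>c. (x :: 'a ordinal) < c"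
proof -
  have "|{x}| \<le>o |UNIV :: ('a + nat) set|"
    by (rule card_of_singl_ordLeq) simp
  from small_bounded[OF this] show ?thesis
    by simp
qed

lemma ord_zero_le: "ord_zero \<le> x"
  unfolding ord_zero_def by (rule Least_le) simp

text \<open>Shows that the \<open>LEAST\<close> defining the sum is attained: the maximum of one
  bound for each of the two families is a candidate.\<close>

lemma nat_add_upper:
  "(\<forall>a'<a. a' +\<^sub>H b < a +\<^sub>H b) \<and> (\<forall>b'<b. a +\<^sub>H b' < a +\<^sub>H b)"
proof -
  obtain c1 where "\<forall>a'<a. a' +\<^sub>H b < c1"
    using lessThan_image_bounded[of a "\<lambda>a'. a' +\<^sub>H b"] by blast
  moreover obtain c2 where "\<forall>b'<b. a +\<^sub>H b' < c2"
    using lessThan_image_bounded[of b "\<lambda>b'. a +\<^sub>H b'"] by blast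
  ultimately have "(\<forall>a'<a. a' +\<^sub>H b < max c1 c2) \<and> (\<forall>b'<b. a +\<^sub>H b' < max c1 c2)"
    by (simp add: less_max_iff_disj)
  then show ?thesis
    unfolding nat_add.simps[of a b] by (rule LeastI)
qed

lemma nat_add_le_iff:
  "a +\<^sub>H b \<le> c \<longleftrightarrow> (\<forall>a'<a. a' +\<^sub>H b < c) \<and> (\<forall>b'<b. a +\<^sub>H b' < c)"
proof
  assume "a +\<^sub>H b \<le> c"
  then show "(\<forall>a'<a. a' +\<^sub>H b < c) \<and> (\<forall>b'<b. a +\<^sub>H b' < c)"
    using nat_add_upper less_le_trans by blast
next
  assume "(\<forall>a'<a. a' +\<^sub>H b < c) \<and> (\<forall>b'<b. a +\<^sub>H b' < c)"
  then show "a +\<^sub>H b \<le> c"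
    unfolding nat_add.simps[of a b] by (rule Least_le)
qed

lemma less_nat_add_iff:
  "c < a +\<^sub>H b \<longleftrightarrow> (\<exists>a'<a. c \<le> a' +\<^sub>H b) \<or> (\<exists>b'<b. c \<le> a +\<^sub>H b')"
  using nat_add_le_iff[of a b c] by (meson not_le)

lemma nat_add_strict_left: "a' < a \<Longrightarrow> a' +\<^sub>H b < a +\<^sub>H b"
  using nat_add_upper by blast

lemma nat_add_strict_right: "b' < b \<Longrightarrow> a +\<^sub>H b' < a +\<^sub>H b"
  using nat_add_upper by blast

lemma nat_add_left_mono: "a' \<le> a \<Longrightarrow> a' +\<^sub>H b \<le> a +\<^sub>H b"
  using nat_add_strict_left by (auto simp: le_less)

lemma nat_add_right_mono: "b' \<le> b \<Longrightarrow> a +\<^sub>H b' \<le> a +\<^sub>H b"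
  using nat_add_strict_right by (auto simp: le_less)

lemma nat_add_commute: "a +\<^sub>H b = b +\<^sub>H a"
proof (induction a b rule: nat_add.induct)
  case (1 a b)
  have "a +\<^sub>H b \<le> c \<longleftrightarrow> b +\<^sub>H a \<le> c" for c
    using 1 by (auto simp: nat_add_le_iff)
  then show ?case
    by (meson order.refl order.antisym)
qed

text \<open>An ordinal below a sum need not be a sum itself; it is only dominated by one in which a
  single argument has been lowered. Any of the three arguments may be the lowered one, hence the
  three nested inductions and the detour through monotonicity.\<close>

lemma nat_add_assoc: "(a +\<^sub>H b) +\<^sub>H c = a +\<^sub>H (b +\<^sub>H c)"
proof (induction a arbitrary: b c rule: less_induct)
  case a: (less a)
  show ?case
  proof (induction b arbitrary: c rule: less_induct)
    case b: (less b)
    show ?case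
    proof (induction c rule: less_induct)
      case c: (less c)
      show ?case
      proof (rule order.antisym)
        show "(a +\<^sub>H b) +\<^sub>H c \<le> a +\<^sub>H (b +\<^sub>H c)"
          unfolding nat_add_le_iff[of "a +\<^sub>H b"]
        proof (intro conjI allI impI)
          fix x assume "x < a +\<^sub>H b"
          then consider a' where "a' < a" "x \<le> a' +\<^sub>H b" | b' where "b' < b" "x \<le> a +\<^sub>H b'"
            by (auto simp: less_nat_add_iff)
          then show "x +\<^sub>H c < a +\<^sub>H (b +\<^sub>H c)"
          proof cases
            case 1
            have "x +\<^sub>H c \<le> (a' +\<^sub>H b) +\<^sub>H c"
              by (rule nat_add_left_mono) fact
            also have "\<dots> = a' +\<^sub>H (b +\<^sub>H c)"
              by (rule a) fact
            also have "\<dots> < a +\<^sub>H (b +\<^sub>H c)"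
              by (rule nat_add_strict_left) fact
            finally show ?thesis .
          next
            case 2
            have "x +\<^sub>H c \<le> (a +\<^sub>H b') +\<^sub>H c"
              by (rule nat_add_left_mono) fact
            also have "\<dots> = a +\<^sub>H (b' +\<^sub>H c)"
              by (rule b) fact
            also have "\<dots> < a +\<^sub>H (b +\<^sub>H c)"
              by (intro nat_add_strict_left nat_add_strict_right) fact
            finally show ?thesis .
          qed
        next
          fix c' assume "c' < c"
          then show "(a +\<^sub>H b) +\<^sub>H c' < a +\<^sub>H (b +\<^sub>H c)"
            by (simp add: c nat_add_strict_right)
        qed
        show "a +\<^sub>H (b +\<^sub>H c) \<le> (a +\<^sub>H b) +\<^sub>H c"
          unfolding nat_add_le_iff[of a "b +\<^sub>H c"]
        proof (intro conjI allI impI)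
          fix a' assume "a' < a"
          then show "a' +\<^sub>H (b +\<^sub>H c) < (a +\<^sub>H b) +\<^sub>H c"
            by (simp add: a[symmetric] nat_add_strict_left)
        next
          fix x assume "x < b +\<^sub>H c"
          then consider b' where "b' < b" "x \<le> b' +\<^sub>H c" | c' where "c' < c" "x \<le> b +\<^sub>H c'"
            by (auto simp: less_nat_add_iff)
          then show "a +\<^sub>H x < (a +\<^sub>H b) +\<^sub>H c"
          proof cases
            case 1
            have "a +\<^sub>H x \<le> a +\<^sub>H (b' +\<^sub>H c)"
              by (rule nat_add_right_mono) fact
            also have "\<dots> = (a +\<^sub>H b') +\<^sub>H c"
              by (rule b[symmetric]) fact
            also have "\<dots> < (a +\<^sub>H b) +\<^sub>H c"
              by (intro nat_add_strict_left nat_add_strict_right) fact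
            finally show ?thesis .
          next
            case 2
            have "a +\<^sub>H x \<le> a +\<^sub>H (b +\<^sub>H c')"
              by (rule nat_add_right_mono) fact
            also have "\<dots> = (a +\<^sub>H b) +\<^sub>H c'"
              by (rule c[symmetric]) fact
            also have "\<dots> < (a +\<^sub>H b) +\<^sub>H c"
              by (intro nat_add_strict_right) fact
            finally show ?thesis .
          qed
        qed
      qed
    qed
  qed
qed

lemma nat_add_zero: "ord_zero +\<^sub>H a = a"
proof (induction a rule: less_induct)
  case (less a)
  have "\<not> a' < (ord_zero :: 'a ordinal)" for a'
    by (simp add: not_less ord_zero_le)
  then have "ord_zero +\<^sub>H a \<le> a"
    using less by (simp add: nat_add_le_iff)
  \<comment> \<open>If \<open>x = ord_zero +\<^sub>H a\<close> were below \<open>a\<close>, the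
    induction hypothesis would give \<open>ord_zero +\<^sub>H x = x\<close>, while strict
    monotonicity gives \<open>ord_zero +\<^sub>H x < x\<close>.\<close>
  moreover have "\<not> ord_zero +\<^sub>H a < a"
    using less nat_add_strict_right by (metis less_irrefl)
  ultimately show ?case
    by simp
qed

instantiation ordinal :: (type) "{zero, one, plus, times}"
begin

definition zero_ordinal :: "'a ordinal" where "0 = ord_zero"
definition one_ordinal :: "'a ordinal" where "1 = ord_one"
definition plus_ordinal :: "'a ordinal \<Rightarrow> 'a ordinal \<Rightarrow> 'a ordinal" where "a + b = a +\<^sub>H b"
definition times_ordinal :: "'a ordinal \<Rightarrow> 'a ordinal \<Rightarrow> 'a ordinal" where "a * b = a *\<^sub>H b"

instance ..

end

lemmas ordinal_folds =
  zero_ordinal_def[symmetric] one_ordinal_def[symmetric] plus_ordinal_def[symmetric]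
  times_ordinal_def[symmetric]

instance ordinal :: (type) "{strict_ordered_comm_monoid_add, linordered_ab_semigroup_add}"
proof
  fix a b c d :: "'a ordinal"
  show "a + b + c = a + (b + c)"
    by (simp add: plus_ordinal_def nat_add_assoc)
  show "a + b = b + a"
    by (simp add: plus_ordinal_def nat_add_commute[of a])
  show "0 + a = a"
    by (simp add: plus_ordinal_def zero_ordinal_def nat_add_zero)
  show "a \<le> b \<Longrightarrow> c + a \<le> c + b"
    by (simp add: plus_ordinal_def nat_add_right_mono)
  show "a < b \<Longrightarrow> c < d \<Longrightarrow> a + c < b + d"
    unfolding plus_ordinal_def by (meson less_trans nat_add_strict_left nat_add_strict_right)
qed

lemmas ordinal_add_le_iff = nat_add_le_iff[unfolded ordinal_folds]
  and less_ordinal_add_iff = less_nat_add_iff[unfolded ordinal_folds]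

lemma ordinal_zero_le [simp]: "0 \<le> (a :: 'a ordinal)"
  by (simp add: zero_ordinal_def ord_zero_le)

lemma ordinal_not_less_zero [simp]: "\<not> (a :: 'a ordinal) < 0"
  by (simp add: not_less)

lemma ordinal_add_less_cancel_right [simp]: "a + c < b + c \<longleftrightarrow> (a :: 'a ordinal) < b"
  unfolding plus_ordinal_def by (meson nat_add_left_mono nat_add_strict_left not_le)

lemma ordinal_add_less_cancel_left [simp]: "c + a < c + b \<longleftrightarrow> (a :: 'a ordinal) < b"
  by (simp add: add.commute[of c])

lemma ordinal_add_le_cancel_right [simp]: "a + c \<le> b + c \<longleftrightarrow> (a :: 'a ordinal) \<le> b"
  by (simp flip: not_less)

lemma ordinal_add_le_cancel_left [simp]: "c + a \<le> c + b \<longleftrightarrow> (a :: 'a ordinal) \<le> b"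
  by (simp flip: not_less)

lemma ordinal_add_cancel_right [simp]: "a + c = b + c \<longleftrightarrow> (a :: 'a ordinal) = b"
  by (simp add: order.eq_iff)

lemma ordinal_add_cancel_left [simp]: "c + a = c + b \<longleftrightarrow> (a :: 'a ordinal) = b"
  by (simp add: order.eq_iff)

lemma ordinal_add_less_le_mono: "a < b \<Longrightarrow> c \<le> d \<Longrightarrow> a + c < b + (d :: 'a ordinal)"
  by (meson add_left_mono less_le_trans ordinal_add_less_cancel_right)

lemma ordinal_le_add [simp]: "a \<le> a + (b :: 'a ordinal)" "a \<le> b + (a :: 'a ordinal)"
  using add_left_mono[of 0 b a] by (simp_all add: add.commute)

lemma ordinal_zero_less_one: "0 < (1 :: 'a ordinal)"
  unfolding one_ordinal_def ord_one_def zero_ordinal_def by (rule LeastI_ex[OF ordinal_gt_ex])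

lemma ordinal_less_one_iff [simp]: "(a :: 'a ordinal) < 1 \<longleftrightarrow> a = 0"
proof
  show "a = 0" if "a < 1"
    using that not_less_Least[of a "\<lambda>c. 0 < c"]
    by (simp add: one_ordinal_def ord_one_def ordinal_folds not_less order.antisym)
qed (simp add: ordinal_zero_less_one)

subsection \<open>The product\<close>

text \<open>With subtraction available, this would read \<open>(a - a') * (b - b') > 0\<close>. The
  \<open>LEAST\<close> is attained because any strict bound of all the left-hand sides is a
  candidate: the product added on the right can only increase that side.\<close>

lemma ordinal_mult_exchange_strict:
  fixes a b :: "'a ordinal"
  assumes "a' < a" "b' < b"
  shows "a' * b + a * b' < a * b + a' * b'"
proof -
  obtain c where "\<forall>a'<a. \<forall>b'<b. a' * b + a * b' < c"
    using lessThan_image_bounded2[of a b "\<lambda>a' b'. a' * b + a * b'"] by blast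
  then have "\<forall>a'<a. \<forall>b'<b. a' * b + a * b' < c + a' * b'"
    by (meson less_le_trans ordinal_le_add)
  then have "\<forall>a'<a. \<forall>b'<b. a' * b + a * b' < a * b + a' * b'"
    unfolding times_ordinal_def[of a b] nat_mult.simps[of a b] unfolding ordinal_folds by (rule LeastI)
  with assms show ?thesis
    by blast
qed

lemma ordinal_mult_le_iff:
  fixes a b c :: "'a ordinal"
  shows "a * b \<le> c \<longleftrightarrow> (\<forall>a'<a. \<forall>b'<b. a' * b + a * b' < c + a' * b')"
proof
  assume "a * b \<le> c"
  then show "\<forall>a'<a. \<forall>b'<b. a' * b + a * b' < c + a' * b'"
    by (meson add_right_mono less_le_trans ordinal_mult_exchange_strict)
next
  assume "\<forall>a'<a. \<forall>b'<b. a' * b + a * b' < c + a' * b'"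
  then show "a * b \<le> c"
    unfolding times_ordinal_def[of a b] nat_mult.simps[of a b] unfolding ordinal_folds by (rule Least_le)
qed

lemma less_ordinal_mult_iff:
  fixes a b c :: "'a ordinal"
  shows "c < a * b \<longleftrightarrow> (\<exists>a'<a. \<exists>b'<b. c + a' * b' \<le> a' * b + a * b')"
  using ordinal_mult_le_iff[of a b c] by (meson not_le)

lemma ordinal_mult_commute: "a * b = b * (a :: 'a ordinal)"
proof (induction a b rule: nat_mult.induct)
  case (1 a b)
  have "a * b \<le> c \<longleftrightarrow> b * a \<le> c" for c
  proof -
    have "(\<forall>a'<a. \<forall>b'<b. a' * b + a * b' < c + a' * b') \<longleftrightarrow>
      (\<forall>b'<b. \<forall>a'<a. b' * a + b * a' < c + b' * a')"
      using 1 by (metis add.commute)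
    then show ?thesis
      by (simp only: ordinal_mult_le_iff)
  qed
  then show ?case
    by (meson order.refl order.antisym)
qed

lemma ordinal_mult_exchange:
  fixes a b :: "'a ordinal"
  assumes "a' \<le> a" "b' \<le> b"
  shows "a' * b + a * b' \<le> a * b + a' * b'"
  using assms ordinal_mult_exchange_strict[of a' a b' b]
  by (cases "a' = a"; cases "b' = b") (auto simp: le_less add.commute)

text \<open>The recursion for products has a product on both sides of its inequality, so the
  estimates are obtained by adding exchange inequalities, expanding with the induction hypotheses
  and cancelling the common summands.\<close>

lemma ordinal_distrib_left: "a * (b + c) = a * b + a * (c :: 'a ordinal)"
proof (induction a arbitrary: b c rule: less_induct)
  case a: (less a)
  show ?case
  proof (induction b arbitrary: c rule: less_induct)
    case b: (less b)
    show ?case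
    proof (induction c rule: less_induct)
      case c: (less c)
      show ?case
      proof (rule order.antisym)
        show "a * (b + c) \<le> a * b + a * c"
          unfolding ordinal_mult_le_iff[of a "b + c"]
        proof (intro allI impI)
          fix a' d assume a': "a' < a" and "d < b + c"
          then consider b' where "b' < b" "d \<le> b' + c" | c' where "c' < c" "d \<le> b + c'"
            by (auto simp: less_ordinal_add_iff)
          then show "a' * (b + c) + a * d < a * b + a * c + a' * d"
          proof cases
            case 1
            \<comment> \<open>A strict exchange for \<open>b' < b\<close> and a weak one for
              \<open>d \<le> b' + c\<close>; after expansion \<open>a * b' + a' * b'\<close> occurs
              on both sides and cancels.\<close>
            have "a' * b + a * b' < a * b + a' * b'"
              using a' 1 by (intro ordinal_mult_exchange_strict)
            moreover have "a' * (b' + c) + a * d \<le> a * (b' + c) + a' * d"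
              using a' 1 by (intro ordinal_mult_exchange) simp_all
            ultimately have "(a' * b + a * b') + (a' * (b' + c) + a * d)
                < (a * b + a' * b') + (a * (b' + c) + a' * d)"
              by (rule ordinal_add_less_le_mono)
            then have "(a' * (b + c) + a * d) + (a * b' + a' * b')
                < (a * b + a * c + a' * d) + (a * b' + a' * b')"
              by (simp only: a[OF a'] b[OF 1(1)] ac_simps)
            then show ?thesis
              by (simp only: ordinal_add_less_cancel_right)
          next
            case 2
            have "a' * c + a * c' < a * c + a' * c'"
              using a' 2 by (intro ordinal_mult_exchange_strict)
            moreover have "a' * (b + c') + a * d \<le> a * (b + c') + a' * d"
              using a' 2 by (intro ordinal_mult_exchange) simp_all
            ultimately have "(a' * c + a * c') + (a' * (b + c') + a * d)
                < (a * c + a' * c') + (a * (b + c') + a' * d)"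
              by (rule ordinal_add_less_le_mono)
            then have "(a' * (b + c) + a * d) + (a * c' + a' * c')
                < (a * b + a * c + a' * d) + (a * c' + a' * c')"
              by (simp only: a[OF a'] c[OF 2(1)] ac_simps)
            then show ?thesis
              by (simp only: ordinal_add_less_cancel_right)
          qed
        qed
        show "a * b + a * c \<le> a * (b + c)"
          unfolding ordinal_add_le_iff[of "a * b"]
        proof (intro conjI allI impI)
          fix x assume "x < a * b"
          then obtain a' b' where a': "a' < a" and b': "b' < b" and
            x: "x + a' * b' \<le> a' * b + a * b'"
            by (auto simp: less_ordinal_mult_iff)
          have "a' * (b + c) + a * (b' + c) < a * (b + c) + a' * (b' + c)"
            using a' b' by (intro ordinal_mult_exchange_strict) simp_all
          then have "((a' * b + a * b') + a * c) + a' * c < (a * (b + c) + a' * b') + a' * c"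
            by (simp only: a[OF a'] b[OF b'] ac_simps)
          then have "(a' * b + a * b') + a * c < a * (b + c) + a' * b'"
            by (simp only: ordinal_add_less_cancel_right)
          with add_right_mono[OF x, of "a * c"]
          have "(x + a * c) + a' * b' < a * (b + c) + a' * b'"
            by (simp add: ac_simps)
          then show "x + a * c < a * (b + c)"
            by (simp only: ordinal_add_less_cancel_right)
        next
          fix x assume "x < a * c"
          then obtain a' c' where a': "a' < a" and c': "c' < c" and
            x: "x + a' * c' \<le> a' * c + a * c'"
            by (auto simp: less_ordinal_mult_iff)
          have "a' * (b + c) + a * (b + c') < a * (b + c) + a' * (b + c')"
            using a' c' by (intro ordinal_mult_exchange_strict) simp_all
          then have "((a' * c + a * c') + a * b) + a' * b < (a * (b + c) + a' * c') + a' * b"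
            by (simp only: a[OF a'] c[OF c'] ac_simps)
          then have "(a' * c + a * c') + a * b < a * (b + c) + a' * c'"
            by (simp only: ordinal_add_less_cancel_right)
          with add_right_mono[OF x, of "a * b"]
          have "(a * b + x) + a' * c' < a * (b + c) + a' * c'"
            by (simp add: ac_simps)
          then show "a * b + x < a * (b + c)"
            by (simp only: ordinal_add_less_cancel_right)
        qed
      qed
    qed
  qed
qed

lemma ordinal_distrib_right: "(a + b) * c = a * c + b * (c :: 'a ordinal)"
  by (simp add: ordinal_mult_commute[of _ c] ordinal_distrib_left)

text \<open>The condition is \<open>(a - a') * (b - b') * (c - c') > 0\<close>, multiplied out, with
  negative terms moved across and \<open>d\<close> put for the leading product. It treats the three
  factors symmetrically, unlike the nested product on the left.\<close>

lemma ordinal_mult3_le_iff: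
  fixes a b c d :: "'a ordinal"
  shows "a * b * c \<le> d \<longleftrightarrow> (\<forall>a'<a. \<forall>b'<b. \<forall>c'<c.
    a' * b * c + a * b' * c + a * b * c' + a' * b' * c'
      < d + a' * b' * c + a' * b * c' + a * b' * c')" (is "?L \<longleftrightarrow> ?R")
proof
  assume L: ?L
  show ?R
  proof (intro allI impI)
    fix a' b' c' assume "a' < a" "b' < b" and c': "c' < c"
    then have "a' * b + a * b' < a * b + a' * b'"
      by (intro ordinal_mult_exchange_strict)
    then have "(a' * b + a * b') * c + (a * b + a' * b') * c'
        < (a * b + a' * b') * c + (a' * b + a * b') * c'"
      using c' by (rule ordinal_mult_exchange_strict)
    also have "\<dots> \<le> (d + a' * b' * c) + (a' * b + a * b') * c'"
      using L by (simp add: ordinal_distrib_right)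
    finally show "a' * b * c + a * b' * c + a * b * c' + a' * b' * c'
      < d + a' * b' * c + a' * b * c' + a * b' * c'"
      by (simp only: ordinal_distrib_right ac_simps)
  qed
next
  assume R: ?R
  show ?L
    unfolding ordinal_mult_le_iff[of "a * b"]
  proof (intro allI impI)
    fix x c' assume "x < a * b" and c': "c' < c"
    then obtain a' b' where a': "a' < a" and b': "b' < b" and
      x: "x + a' * b' \<le> a' * b + a * b'"
      by (auto simp: less_ordinal_mult_iff)
    have "a' * b * c + a * b' * c + a * b * c' + a' * b' * c'
      < d + a' * b' * c + a' * b * c' + a * b' * c'"
      using R a' b' c' by blast
    \<comment> \<open>The bound on \<open>x\<close> cannot be multiplied by \<open>c - c'\<close>;
      the weak exchange inequality does the same without subtraction. Added to the instance of
      \<open>R\<close>, it leaves the claim plus six common terms.\<close>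
    moreover have "(x + a' * b') * c + (a' * b + a * b') * c'
        \<le> (a' * b + a * b') * c + (x + a' * b') * c'"
      using x c' by (intro ordinal_mult_exchange) simp_all
    ultimately have
      "(a' * b * c + a * b' * c + a * b * c' + a' * b' * c') +
          ((x + a' * b') * c + (a' * b + a * b') * c')
      < (d + a' * b' * c + a' * b * c' + a * b' * c') +
          ((a' * b + a * b') * c + (x + a' * b') * c')"
      by (rule ordinal_add_less_le_mono)
    then have "(x * c + a * b * c') +
        (a' * b * c + a * b' * c + a' * b' * c' + a' * b' * c + a' * b * c' + a * b' * c')
      < (d + x * c') +
        (a' * b * c + a * b' * c + a' * b' * c' + a' * b' * c + a' * b * c' + a * b' * c')"
      by (simp only: ordinal_distrib_right ac_simps)
    then show "x * c + a * b * c' < d + x * c'"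
      by (simp only: ordinal_add_less_cancel_right)
  qed
qed

text \<open>Associativity in a form that the triple recursion can reach: both sides are nested to
  the left, and the conditions on their upper bounds are cyclic rotations of each other.
  Commutativity then turns rotation into associativity.\<close>

lemma ordinal_mult_rotate: "a * b * c = b * c * (a :: 'a ordinal)"
proof (induction a arbitrary: b c rule: less_induct)
  case a: (less a)
  show ?case
  proof (induction b arbitrary: c rule: less_induct)
    case b: (less b)
    show ?case
    proof (induction c rule: less_induct)
      case c: (less c)
      have "a * b * c \<le> d \<longleftrightarrow> b * c * a \<le> d" for d
      proof -
        have "(a' * b * c + a * b' * c + a * b * c' + a' * b' * c'
            < d + a' * b' * c + a' * b * c' + a * b' * c') \<longleftrightarrow>
          (b' * c * a + b * c' * a + b * c * a' + b' * c' * a'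
            < d + b' * c' * a + b' * c * a' + b * c' * a')"
          if "a' < a" "b' < b" "c' < c" for a' b' c'
          by (simp only: a[OF that(1)] b[OF that(2)] c[OF that(3)] add_ac)
        then show ?thesis
          unfolding ordinal_mult3_le_iff by blast
      qed
      then show ?case
        by (meson order.refl order.antisym)
    qed
  qed
qed

instance ordinal :: (type) comm_semiring_1
proof
  fix a b c :: "'a ordinal"
  show "a * b = b * a"
    by (rule ordinal_mult_commute)
  show "a * b * c = a * (b * c)"
    using ordinal_mult_rotate[of a b c] ordinal_mult_commute[of "b * c" a] by simp
  show "(a + b) * c = a * c + b * c"
    by (rule ordinal_distrib_right)
  have zero: "x * 0 = 0" "0 * x = 0" for x :: "'a ordinal"
    by (simp_all add: order.eq_iff ordinal_mult_le_iff)
  show "0 * a = 0" "a * 0 = 0"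
    by (rule zero)+
  have "a * 1 = a"
  proof (induction a rule: less_induct)
    case (less a)
    \<comment> \<open>Only \<open>0\<close> lies below \<open>1\<close>, so by the induction
      hypothesis the recursive condition shrinks to \<open>a' < c\<close> for all
      \<open>a' < a\<close>.\<close>
    then have "a * 1 \<le> c \<longleftrightarrow> a \<le> c" for c
      by (auto simp: ordinal_mult_le_iff[of a 1] zero not_le intro: leI)
    then show ?case
      by (meson order.refl order.antisym)
  qed
  then show "1 * a = a"
    by (simp add: ordinal_mult_commute)
  show "(0 :: 'a ordinal) \<noteq> 1"
    using ordinal_zero_less_one by (metis less_irrefl)
qed

lemma ordinal_mult_left_mono: "b \<le> c \<Longrightarrow> a * b \<le> a * (c :: 'a ordinal)"
  using ordinal_mult_exchange[of 0 a b c] by simp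

lemma ordinal_mult_mono: "a \<le> b \<Longrightarrow> c \<le> d \<Longrightarrow> a * c \<le> b * (d :: 'a ordinal)"
  by (metis mult.commute order.trans ordinal_mult_left_mono)


section \<open>Closure of the ordinals below \<open>\<omega> ^ \<omega> ^ \<alpha>\<close>\<close>

lemma ord_add_le_iff: "ord_add a b \<le> c \<longleftrightarrow> a \<le> c \<and> (\<forall>b'<b. ord_add a b' < c)"
proof
  obtain d where "\<forall>b'<b. ord_add a b' < d"
    using lessThan_image_bounded[of b "ord_add a"] by blast
  then have "a \<le> max a d \<and> (\<forall>b'<b. ord_add a b' < max a d)"
    by (simp add: less_max_iff_disj)
  then have "a \<le> ord_add a b \<and> (\<forall>b'<b. ord_add a b' < ord_add a b)"
    unfolding ord_add.simps[of a b] by (rule LeastI)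
  then show "a \<le> c \<and> (\<forall>b'<b. ord_add a b' < c)" if "ord_add a b \<le> c"
    using that by (meson less_le_trans order.trans)
next
  assume "a \<le> c \<and> (\<forall>b'<b. ord_add a b' < c)"
  then show "ord_add a b \<le> c"
    unfolding ord_add.simps[of a b] by (rule Least_le)
qed

lemma ord_mult_le_iff: "ord_mult a b \<le> c \<longleftrightarrow> (\<forall>b'<b. ord_add (ord_mult a b') a \<le> c)"
proof
  obtain d where "\<forall>b'<b. ord_add (ord_mult a b') a < d"
    using lessThan_image_bounded[of b "\<lambda>b'. ord_add (ord_mult a b') a"] by blast
  then have "\<forall>b'<b. ord_add (ord_mult a b') a \<le> d"
    by (simp add: less_imp_le)
  then have "\<forall>b'<b. ord_add (ord_mult a b') a \<le> ord_mult a b"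
    unfolding ord_mult.simps[of a b] by (rule LeastI)
  then show "\<forall>b'<b. ord_add (ord_mult a b') a \<le> c" if "ord_mult a b \<le> c"
    using that by (meson order.trans)
next
  assume "\<forall>b'<b. ord_add (ord_mult a b') a \<le> c"
  then show "ord_mult a b \<le> c"
    unfolding ord_mult.simps[of a b] by (rule Least_le)
qed

lemma omega_pow_le_iff:
  "omega_pow b \<le> c \<longleftrightarrow> 1 \<le> c \<and> (\<forall>b'<b. ord_mult (omega_pow b') ord_omega \<le> c)"
proof
  obtain d where "\<forall>b'<b. ord_mult (omega_pow b') ord_omega < d"
    using lessThan_image_bounded[of b "\<lambda>b'. ord_mult (omega_pow b') ord_omega"] by blast
  then have "ord_one \<le> max 1 d \<and> (\<forall>b'<b. ord_mult (omega_pow b') ord_omega \<le> max 1 d)"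
    by (simp add: less_imp_le le_max_iff_disj ordinal_folds)
  then have "ord_one \<le> omega_pow b \<and> (\<forall>b'<b. ord_mult (omega_pow b') ord_omega \<le> omega_pow b)"
    unfolding omega_pow.simps[of b] by (rule LeastI)
  then show "1 \<le> c \<and> (\<forall>b'<b. ord_mult (omega_pow b') ord_omega \<le> c)" if "omega_pow b \<le> c"
    using that unfolding ordinal_folds by (meson order.trans)
next
  assume "1 \<le> c \<and> (\<forall>b'<b. ord_mult (omega_pow b') ord_omega \<le> c)"
  then show "omega_pow b \<le> c"
    unfolding omega_pow.simps[of b] ordinal_folds by (rule Least_le)
qed

section \<open>Finite ordinals and omega\<close>

lemma ordinal_add_one_le: "a + 1 \<le> x" if "a < (x :: 'a ordinal)"
  using that
proof (induction a arbitrary: x rule: less_induct)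
  case (less a)
  have "a' + 1 < x" if "a' < a" for a'
    using less.IH[OF that that] less.prems by simp
  with less.prems show ?case
    by (simp add: ordinal_add_le_iff)
qed

lemma ordinal_of_nat_less_Suc: "of_nat n < (of_nat (Suc n) :: 'a ordinal)"
  using ordinal_add_less_cancel_left[of "of_nat n" 0 1] ordinal_zero_less_one
  by (simp add: add.commute)

lemma ordinal_of_nat_less: "m < n \<Longrightarrow> of_nat m < (of_nat n :: 'a ordinal)"
  by (rule lift_Suc_mono_less[of of_nat]) (rule ordinal_of_nat_less_Suc)

lemma ordinal_of_nat_mono: "m \<le> n \<Longrightarrow> of_nat m \<le> (of_nat n :: 'a ordinal)"
  using ordinal_of_nat_less[of m n] by (auto simp: le_less)

lemma inj_ordinal_of_nat: "inj (of_nat :: nat \<Rightarrow> 'a ordinal)"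
  by (metis injI less_irrefl linorder_neqE_nat ordinal_of_nat_less)

lemma less_ordinal_of_nat_iff: "x < of_nat n \<longleftrightarrow> (\<exists>m<n. x = (of_nat m :: 'a ordinal))"
proof
  show "x < of_nat n \<Longrightarrow> \<exists>m<n. x = of_nat m"
  proof (induction n)
    case (Suc n)
    have "x \<le> of_nat n"
    proof (rule ccontr)
      assume "\<not> x \<le> of_nat n"
      with ordinal_add_one_le[of "of_nat n" x] Suc.prems show False
        by (simp add: add.commute not_le)
    qed
    with Suc.IH show ?case
      by (auto simp: le_less intro: less_SucI)
  qed simp
qed (auto intro: ordinal_of_nat_less)

lemma less_ord_omega_iff: "x < ord_omega \<longleftrightarrow> (\<exists>n. x = (of_nat n :: 'a ordinal))"
proof
  assume "x < ord_omega"
  then have fin: "finite {..<x}"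
    unfolding ord_omega_def by (auto dest: not_less_Least)
  show "\<exists>n. x = of_nat n"
  proof (rule ccontr)
    assume contr: "\<not> ?thesis"
    have "of_nat n < x" for n
    proof (induction n)
      case 0
      then show ?case
        using contr[unfolded not_ex, rule_format, of 0] by (auto simp: order_less_le)
    next
      case (Suc n)
      from ordinal_add_one_le[OF this] show ?case
        using contr[unfolded not_ex, rule_format, of "Suc n"] by (simp add: le_less add.commute)
    qed
    then have "range of_nat \<subseteq> {..<x}"
      by auto
    with fin have "finite (range (of_nat :: nat \<Rightarrow> 'a ordinal))"
      by (rule rev_finite_subset)
    then show False
      using inj_ordinal_of_nat finite_imageD infinite_UNIV_nat by blast
  qed
next
  \<comment> \<open>An infinite initial segment must exist for the \<open>LEAST\<close> in
    \<open>ord_omega\<close> to mean anything; \<open>Inr\<close> embeds \<open>nat\<close>, so the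
    finite ordinals are bounded.\<close>
  have "|UNIV :: nat set| \<le>o |UNIV :: ('a + nat) set|"
    by (rule card_of_ordLeq[THEN iffD1]) (auto intro!: exI[of _ Inr])
  from small_image_bounded[OF this, of of_nat] obtain c where "range of_nat \<subseteq> {..<c :: 'a ordinal}"
    by auto
  then have "infinite {..<c}"
    using inj_ordinal_of_nat finite_imageD infinite_UNIV_nat finite_subset by blast
  then have inf: "infinite {..<ord_omega :: 'a ordinal}"
    unfolding ord_omega_def by (rule LeastI)
  assume "\<exists>n. x = of_nat n"
  then obtain n where n: "x = of_nat n" ..
  have "{..<x} \<subseteq> of_nat ` {..<n}"
    by (auto simp: n less_ordinal_of_nat_iff)
  then have "finite {..<x}"
    by (rule finite_subset) simp
  with inf show "x < ord_omega"
    by (meson finite_subset ivl_subset lessThan_subset_iff not_le)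
qed

section \<open>Ordinals additively indecomposable for the natural sum, and their finite
  multiples\<close>

definition add_closed :: "'a ordinal \<Rightarrow> bool" where
  "add_closed w \<longleftrightarrow> 0 < w \<and> (\<forall>x<w. \<forall>y<w. x + y < w)"

lemma ordinal_mult_right_mono: "a \<le> b \<Longrightarrow> a * c \<le> b * (c :: 'a ordinal)"
  by (rule ordinal_mult_mono) simp_all

text \<open>
  The second part, a weak division with remainder by \<open>w\<close>, is what makes the ordinary and the
  Hessenberg sum agree in the first.
\<close>

lemma multiple_add_closed:
  assumes w: "add_closed w"
  shows "(\<forall>x\<le>w. ord_add (of_nat n * w) x = of_nat n * w + x) \<and>
    (\<forall>y < of_nat n * w. \<exists>k<n. \<exists>z<w. y \<le> of_nat k * w + z)"
proof (induction n)
  \<comment> \<open>Agreement of the sums at \<open>n\<close> needs the division property only at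
    the same \<open>n\<close>, so it is separated from the induction, which then has to carry just
    the division from \<open>n\<close> to \<open>Suc n\<close>.\<close>
  have agree: "ord_add (of_nat n * w) x = of_nat n * w + x"
    if div: "\<forall>y < of_nat n * w. \<exists>k<n. \<exists>z<w. y \<le> of_nat k * w + z" and "x \<le> w" for n x
    using \<open>x \<le> w\<close>
  proof (induction x rule: less_induct)
    case (less x)
    let ?v = "of_nat n * w"
    have "ord_add ?v x \<le> c \<longleftrightarrow> ?v + x \<le> c" for c
    proof
      assume "ord_add ?v x \<le> c"
      then have v: "?v \<le> c" and x': "\<forall>x'<x. ?v + x' < c"
        using less by (auto simp: ord_add_le_iff[of ?v x])
      show "?v + x \<le> c"
        unfolding ordinal_add_le_iff[of ?v x]
      proof (intro conjI allI impI)
        fix y assume "y < ?v"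
        with div obtain k z where k: "k < n" and z: "z < w" and y: "y \<le> of_nat k * w + z"
          by blast
        have k_le: "of_nat k * w + w \<le> ?v"
          using ordinal_mult_right_mono[OF ordinal_of_nat_mono, of "Suc k" n w] k
          by (simp add: algebra_simps)
        \<comment> \<open>If \<open>x = w\<close>, this summand completes
          \<open>of_nat k * w\<close> to the next multiple, at most \<open>of_nat n * w\<close>, and
          leaves \<open>z < x\<close>, to which \<open>x'\<close> applies. If \<open>x < w\<close>,
          then \<open>z + x\<close> stays below \<open>w\<close>, and \<open>y + x\<close> does not
          even reach \<open>of_nat n * w\<close>.\<close>
        show "y + x < c"
        proof (cases "x = w")
          case True
          have "y + x \<le> of_nat k * w + z + w"
            using y by (simp add: True)
          also have "\<dots> \<le> ?v + z"
            using add_right_mono[OF k_le, of z] by (simp add: ac_simps)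
          also have "\<dots> < c"
            using x' z True by blast
          finally show ?thesis .
        next
          case False
          have "y + x \<le> of_nat k * w + (z + x)"
            using add_right_mono[OF y, of x] by (simp add: ac_simps)
          also have "\<dots> < of_nat k * w + w"
            using False less.prems z w by (simp add: add_closed_def)
          also have "\<dots> \<le> c"
            using k_le v by (rule order.trans)
          finally show ?thesis .
        qed
      qed (use x' in blast)
    next
      assume c: "?v + x \<le> c"
      have "?v \<le> ?v + x"
        by simp
      then have "?v \<le> c"
        using c by (rule order.trans)
      moreover have "\<forall>x'<x. ord_add ?v x' < c"
        using c less by (auto simp: ordinal_add_le_iff[of ?v x])
      ultimately show "ord_add ?v x \<le> c"
        by (simp add: ord_add_le_iff[of ?v x])
    qed
    then show ?case
      by (meson order.refl order.antisym)
  qed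
  case 0
  show ?case
    using agree[of 0] by simp
  case (Suc n)
  have "\<exists>k<Suc n. \<exists>z<w. y \<le> of_nat k * w + z" if y: "y < of_nat (Suc n) * w" for y
  proof -
    \<comment> \<open>The passage to the ordinary sum is the point: below it, only the right summand
      is ever lowered, which yields a remainder \<open>z < w\<close>. The recursion of the natural
      sum could also lower \<open>of_nat n * w\<close> instead.\<close>
    have "\<not> ord_add (of_nat n * w) w \<le> y"
      using y Suc by (simp add: algebra_simps not_le)
    then have "y < of_nat n * w \<or> (\<exists>z<w. y \<le> ord_add (of_nat n * w) z)"
      unfolding ord_add_le_iff[of _ w] by (auto simp: not_le not_less)
    then consider "y < of_nat n * w" | z where "z < w" "y \<le> of_nat n * w + z"
      using Suc by fastforce
    then show ?thesis
      using Suc by cases (blast intro: less_SucI)+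
  qed
  then show ?case
    using agree[of "Suc n"] by blast
qed

lemma ord_mult_of_nat:
  assumes "add_closed w"
  shows "ord_mult w (of_nat n) = of_nat n * w"
proof (induction n rule: less_induct)
  case (less n)
  have "ord_mult w (of_nat n) \<le> c \<longleftrightarrow> (\<forall>m<n. of_nat (Suc m) * w \<le> c)" for c
    using less multiple_add_closed[OF assms]
    by (auto simp: ord_mult_le_iff[of w "of_nat n"] less_ordinal_of_nat_iff algebra_simps)
  also have "(\<forall>m<n. of_nat (Suc m) * w \<le> c) \<longleftrightarrow> of_nat n * w \<le> c" for c
  proof (cases n)
    case (Suc k)
    have "of_nat (Suc m) * w \<le> of_nat n * w" if "m < n" for m
      using that by (intro ordinal_mult_right_mono ordinal_of_nat_mono) simp
    then show ?thesis
      using Suc by (meson lessI order.trans)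
  qed simp
  finally show ?case
    by (meson order.refl order.antisym)
qed

lemma less_ord_mult_omega_iff:
  assumes "add_closed w"
  shows "x < ord_mult w ord_omega \<longleftrightarrow> (\<exists>n. x < of_nat n * w)"
proof -
  have "ord_add (ord_mult w (of_nat n)) w = of_nat (Suc n) * w" for n
    using multiple_add_closed[OF assms, of n] by (simp add: ord_mult_of_nat[OF assms] algebra_simps)
  then have "ord_mult w ord_omega \<le> x \<longleftrightarrow> (\<forall>n. of_nat (Suc n) * w \<le> x)"
    by (metis ord_mult_le_iff less_ord_omega_iff)
  then have "x < ord_mult w ord_omega \<longleftrightarrow> (\<exists>n. x < of_nat (Suc n) * w)"
    by (meson not_le)
  \<comment> \<open>Nothing lies below the multiple for \<open>n = 0\<close>, so the shift by one
    changes nothing.\<close>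
  also have "\<dots> \<longleftrightarrow> (\<exists>n. x < of_nat n * w)"
    by (metis not0_implies_Suc mult_zero_left of_nat_0 ordinal_not_less_zero)
  finally show ?thesis .
qed

section \<open>Powers of omega under the natural operations\<close>

lemma omega_pow_mono: "a \<le> b \<Longrightarrow> omega_pow a \<le> omega_pow b"
  using omega_pow_le_iff[of b "omega_pow b"] by (simp add: omega_pow_le_iff[of a])

lemma one_le_omega_pow: "1 \<le> omega_pow a"
  using omega_pow_le_iff[of a "omega_pow a"] by simp

lemma omega_pow_pos: "0 < omega_pow a"
  by (rule less_le_trans[OF ordinal_zero_less_one one_le_omega_pow])

text \<open>Closedness is assumed only below \<open>b\<close> because the lemma serves in the very
  induction that proves it for all powers; \<open>less_omega_pow_iff\<close> is the version without
  the assumption.\<close>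

lemma less_omega_pow_iff':
  assumes "\<And>b'. b' < b \<Longrightarrow> add_closed (omega_pow b')"
  shows "x < omega_pow b \<longleftrightarrow> x = 0 \<or> (\<exists>b'<b. \<exists>n. x < of_nat n * omega_pow b')"
  using omega_pow_le_iff[of b x] less_ord_mult_omega_iff[OF assms]
  by (metis not_le ordinal_less_one_iff)

text \<open>Two nonzero ordinals below \<open>omega_pow b\<close> lie below finite multiples of
  smaller powers; raising both to the larger exponent lets the coefficients be added.\<close>

lemma add_closed_omega_pow: "add_closed (omega_pow b)"
proof (induction b rule: less_induct)
  case (less b)
  note iff = less_omega_pow_iff'[OF less]
  have "x + y < omega_pow b" if xy: "x < omega_pow b" "y < omega_pow b" for x y
  proof (cases "x = 0 \<or> y = 0")
    case False
    with xy obtain b1 n b2 m where b: "b1 < b" "b2 < b" and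
      x: "x < of_nat n * omega_pow b1" and y: "y < of_nat m * omega_pow b2"
      by (auto simp: iff)
    have "x + y < of_nat n * omega_pow b1 + of_nat m * omega_pow b2"
      using x y by (rule add_strict_mono)
    also have "\<dots> \<le> of_nat n * omega_pow (max b1 b2) + of_nat m * omega_pow (max b1 b2)"
      by (intro add_mono ordinal_mult_left_mono omega_pow_mono) simp_all
    also have "\<dots> = of_nat (n + m) * omega_pow (max b1 b2)"
      by (simp add: algebra_simps)
    finally show ?thesis
      using b iff by (metis max_def)
  qed (use xy in auto)
  then show ?case
    by (simp add: add_closed_def omega_pow_pos)
qed

lemmas less_omega_pow_iff = less_omega_pow_iff'[OF add_closed_omega_pow]

lemma add_less_omega_pow: "x < omega_pow b \<Longrightarrow> y < omega_pow b \<Longrightarrow> x + y < omega_pow b"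
  using add_closed_omega_pow[of b] by (simp add: add_closed_def)

lemma multiple_less_omega_pow:
  assumes "a < b"
  shows "of_nat n * omega_pow a < omega_pow b"
proof -
  have "of_nat n * omega_pow a < of_nat (Suc n) * omega_pow a"
    using ordinal_add_less_cancel_left[of "of_nat n * omega_pow a" 0 "omega_pow a"] omega_pow_pos
    by (simp add: algebra_simps)
  with assms show ?thesis
    using less_omega_pow_iff by blast
qed

text \<open>By the product recursion it is enough that the mixed products
  \<open>x * omega_pow b\<close> and \<open>omega_pow a * y\<close> have a sum below
  \<open>omega_pow (a + b)\<close>. Each is below it by lowering one exponent, and the bound is
  additively closed.\<close>

lemma omega_pow_mult_le: "omega_pow a * omega_pow b \<le> omega_pow (a + b)"
proof (induction a b rule: nat_add.induct)
  case (1 a b)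
  show ?case
    unfolding ordinal_mult_le_iff[of "omega_pow a"]
  proof (intro allI impI)
    fix x y assume x: "x < omega_pow a" and y: "y < omega_pow b"
    have "x * omega_pow b < omega_pow (a + b)"
    proof (cases "x = 0")
      case False
      with x obtain a' n where a': "a' < a" and "x < of_nat n * omega_pow a'"
        by (auto simp: less_omega_pow_iff)
      then have "x * omega_pow b \<le> of_nat n * omega_pow a' * omega_pow b"
        by (intro ordinal_mult_right_mono) simp
      also have "\<dots> \<le> of_nat n * omega_pow (a' + b)"
        unfolding mult.assoc by (intro ordinal_mult_left_mono 1 a')
      also have "\<dots> < omega_pow (a + b)"
        by (rule multiple_less_omega_pow) (simp add: a')
      finally show ?thesis .
    qed (simp add: omega_pow_pos)
    moreover have "omega_pow a * y < omega_pow (a + b)"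
    proof (cases "y = 0")
      case False
      with y obtain b' n where b': "b' < b" and "y < of_nat n * omega_pow b'"
        by (auto simp: less_omega_pow_iff)
      then have "omega_pow a * y \<le> omega_pow a * (of_nat n * omega_pow b')"
        by (intro ordinal_mult_left_mono) simp
      also have "\<dots> = of_nat n * (omega_pow a * omega_pow b')"
        by (simp add: ac_simps)
      also have "\<dots> \<le> of_nat n * omega_pow (a + b')"
        by (intro ordinal_mult_left_mono 1 b')
      also have "\<dots> < omega_pow (a + b)"
        by (rule multiple_less_omega_pow) (simp add: b')
      finally show ?thesis .
    qed (simp add: omega_pow_pos)
    ultimately have "x * omega_pow b + omega_pow a * y < omega_pow (a + b)"
      by (rule add_less_omega_pow)
    also have "\<dots> \<le> omega_pow (a + b) + x * y"
      by simp
    finally show "x * omega_pow b + omega_pow a * y < omega_pow (a + b) + x * y" .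
  qed
qed

lemma NN_zero: "0 \<in> NN \<alpha>"
  by (simp add: NN_def omega_pow_pos)

lemma NN_one: "1 \<in> NN \<alpha>"
proof -
  have "1 \<le> of_nat 1 * omega_pow 0"
    using one_le_omega_pow by simp
  also have "\<dots> < omega_pow (omega_pow \<alpha>)"
    by (intro multiple_less_omega_pow omega_pow_pos)
  finally show ?thesis
    by (simp add: NN_def)
qed

lemma NN_add: "x \<in> NN \<alpha> \<Longrightarrow> y \<in> NN \<alpha> \<Longrightarrow> x + y \<in> NN \<alpha>"
  by (simp add: NN_def add_less_omega_pow)

text \<open>Here the double exponent is used: the exponents \<open>a\<close> and \<open>b\<close>
  lie below \<open>omega_pow \<alpha>\<close>, which is itself a power of omega, so their natural
  sum does too.\<close>

lemma NN_mult:
  assumes "x \<in> NN \<alpha>" "y \<in> NN \<alpha>"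
  shows "x * y \<in> NN \<alpha>"
proof (cases "x = 0 \<or> y = 0")
  case False
  with assms obtain a b n m where ab: "a < omega_pow \<alpha>" "b < omega_pow \<alpha>" and
    "x < of_nat n * omega_pow a" "y < of_nat m * omega_pow b"
    by (auto simp: NN_def less_omega_pow_iff[of _ "omega_pow \<alpha>"])
  then have "x * y \<le> (of_nat n * omega_pow a) * (of_nat m * omega_pow b)"
    by (intro ordinal_mult_mono) simp_all
  also have "\<dots> = of_nat (n * m) * (omega_pow a * omega_pow b)"
    by (simp add: ac_simps)
  also have "\<dots> \<le> of_nat (n * m) * omega_pow (a + b)"
    by (intro ordinal_mult_left_mono omega_pow_mult_le)
  also have "\<dots> < omega_pow (omega_pow \<alpha>)"
    by (intro multiple_less_omega_pow add_less_omega_pow ab)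
  finally show ?thesis
    by (simp add: NN_def)
qed (use NN_zero in auto)


section \<open>Differences of ordinals\<close>

\<comment> \<open>otherwise \<open>lift_definition\<close> below would lift through the quotient of well-orders as well\<close>
lifting_forget ordinal.lifting

definition odiff_rel :: "'a ordinal \<times> 'a ordinal \<Rightarrow> 'a ordinal \<times> 'a ordinal \<Rightarrow> bool" where
  "odiff_rel = (\<lambda>(a, b) (c, d). a + d = b + c)"

lemma odiff_rel_iff [simp]: "odiff_rel (a, b) (c, d) \<longleftrightarrow> a + d = b + c"
  by (simp add: odiff_rel_def)

quotient_type 'a odiff = "'a ordinal \<times> 'a ordinal" / odiff_rel
  morphisms Rep_odiff Abs_odiff
proof (rule equivpI)
  show "reflp (odiff_rel :: 'a ordinal \<times> 'a ordinal \<Rightarrow> _)"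
    by (auto simp: reflp_def add.commute)
  show "symp (odiff_rel :: 'a ordinal \<times> 'a ordinal \<Rightarrow> _)"
    by (auto simp: symp_def add.commute)
  show "transp (odiff_rel :: 'a ordinal \<times> 'a ordinal \<Rightarrow> _)"
  proof (rule transpI, clarsimp)
    fix a b c d e f :: "'a ordinal"
    assume "a + d = b + c" "c + f = d + e"
    then have "(a + d) + (c + f) = (b + c) + (d + e)"
      by simp
    then have "(a + f) + (c + d) = (b + e) + (c + d)"
      by (simp only: ac_simps)
    then show "a + f = b + e"
      by simp
  qed
qed

lift_definition odiff :: "'a ordinal \<Rightarrow> 'a ordinal \<Rightarrow> 'a odiff" is Pair .

lemma odiff_eq_iff: "odiff a b = odiff c d \<longleftrightarrow> a + d = b + c"
  by transfer simp

lemma odiff_cases [case_names odiff, cases type: odiff]: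
  obtains a b where "x = odiff a b"
proof -
  have "\<exists>a b. x = odiff a b"
    by transfer (metis add.commute odiff_rel_iff surj_pair)
  with that show thesis
    by blast
qed

instantiation odiff :: (type) comm_ring_1
begin

lift_definition zero_odiff :: "'a odiff" is "(0, 0)" .

lift_definition one_odiff :: "'a odiff" is "(1, 0)" .

lift_definition plus_odiff :: "'a odiff \<Rightarrow> 'a odiff \<Rightarrow> 'a odiff"
  is "\<lambda>(a, b) (c, d). (a + c, b + d)"
proof clarsimp
  fix a b a' b' c d c' d' :: "'a ordinal"
  assume "a + b' = b + a'" "c + d' = d + c'"
  then have "(a + b') + (c + d') = (b + a') + (d + c')"
    by simp
  then show "a + c + (b' + d') = b + d + (a' + c')"
    by (simp only: ac_simps)
qed

lift_definition uminus_odiff :: "'a odiff \<Rightarrow> 'a odiff"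
  is "\<lambda>(a, b). (b, a)"
  by clarsimp

lift_definition times_odiff :: "'a odiff \<Rightarrow> 'a odiff \<Rightarrow> 'a odiff"
  is "\<lambda>(a, b) (c, d). (a * c + b * d, a * d + b * c)"
proof clarsimp
  fix a b a' b' c d c' d' :: "'a ordinal"
  assume 1: "a + b' = b + a'" and 2: "c + d' = d + c'"
  \<comment> \<open>One factor is exchanged at a time: the first two terms pass from
    \<open>(a, b)\<close> to \<open>(a', b')\<close>, the last two from \<open>(c, d)\<close> to
    \<open>(c', d')\<close>. The mixed products of the intermediate stage appear on both sides and
    cancel.\<close>
  have "(a + b') * c + (b + a') * d + a' * (c + d') + b' * (d + c')
      = (b + a') * c + (a + b') * d + a' * (d + c') + b' * (c + d')"
    by (simp only: 1 2)
  then have "(a * c + b * d + (a' * d' + b' * c')) + (a' * c + a' * d + b' * c + b' * d)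
      = (a * d + b * c + (a' * c' + b' * d')) + (a' * c + a' * d + b' * c + b' * d)"
    by (simp only: distrib_left distrib_right ac_simps)
  then show "a * c + b * d + (a' * d' + b' * c') = a * d + b * c + (a' * c' + b' * d')"
    by simp
qed

definition minus_odiff :: "'a odiff \<Rightarrow> 'a odiff \<Rightarrow> 'a odiff" where
  "x - y = x + - y" for x y :: "'a odiff"

lemma odiff_arith:
  "odiff a b + odiff c d = odiff (a + c) (b + d)"
  "- odiff a b = odiff b a"
  "odiff a b * odiff c d = odiff (a * c + b * d) (a * d + b * c)"
  "0 = odiff 0 0" "1 = odiff 1 0"
  by (simp_all add: odiff.abs_eq plus_odiff.abs_eq uminus_odiff.abs_eq times_odiff.abs_eq
      zero_odiff_def one_odiff_def)

instance
proof
  fix x y z :: "'a odiff"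
  obtain a b c d e f where xyz: "x = odiff a b" "y = odiff c d" "z = odiff e f"
    by (metis odiff_cases)
  show "x * y * z = x * (y * z)" "x + y + z = x + (y + z)" "(x + y) * z = x * z + y * z"
    by (simp_all only: xyz odiff_arith odiff_eq_iff distrib_left distrib_right ac_simps)
  show "x * y = y * x" "x + y = y + x" "1 * x = x" "0 + x = x" "- x + x = 0"
    by (simp_all add: xyz odiff_arith odiff_eq_iff ac_simps)
  show "(0 :: 'a odiff) \<noteq> 1"
    by (simp add: odiff_arith odiff_eq_iff)
  show "x - y = x + - y"
    by (rule minus_odiff_def)
qed

end

instantiation odiff :: (type) linordered_idom
begin

lift_definition less_eq_odiff :: "'a odiff \<Rightarrow> 'a odiff \<Rightarrow> bool"
  is "\<lambda>(a, b) (c, d). a + d \<le> b + c"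
proof clarsimp
  fix a b a' b' c d c' d' :: "'a ordinal"
  assume 1: "a + b' = b + a'" and 2: "c + d' = d + c'"
  have "a + d \<le> b + c \<longleftrightarrow> (a + d) + (b' + d') \<le> (b + c) + (b' + d')"
    by simp
  also have "\<dots> \<longleftrightarrow> (a + b') + (d + d') \<le> (c + d') + (b + b')"
    by (simp only: ac_simps)
  also have "\<dots> \<longleftrightarrow> (a' + d') + (b + d) \<le> (b' + c') + (b + d)"
    unfolding 1 2 by (simp only: ac_simps)
  finally show "a + d \<le> b + c \<longleftrightarrow> a' + d' \<le> b' + c'"
    by simp
qed

definition less_odiff :: "'a odiff \<Rightarrow> 'a odiff \<Rightarrow> bool" where
  "x < y \<longleftrightarrow> x \<le> y \<and> \<not> y \<le> x" for x y :: "'a odiff"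

definition abs_odiff :: "'a odiff \<Rightarrow> 'a odiff" where
  "\<bar>x\<bar> = (if x < 0 then - x else x)" for x :: "'a odiff"

definition sgn_odiff :: "'a odiff \<Rightarrow> 'a odiff" where
  "sgn x = (if x = 0 then 0 else if 0 < x then 1 else - 1)" for x :: "'a odiff"

lemma odiff_le_iff: "odiff a b \<le> odiff c d \<longleftrightarrow> a + d \<le> b + c"
  by transfer simp

lemma odiff_less_iff: "odiff a b < odiff c d \<longleftrightarrow> a + d < b + c"
  by (auto simp: less_odiff_def odiff_le_iff add.commute)

instance
proof
  fix x y z :: "'a odiff"
  obtain a b c d e f where [simp]: "x = odiff a b" "y = odiff c d" "z = odiff e f"
    by (metis odiff_cases)
  show "x \<le> x"
    by (simp add: odiff_le_iff add.commute)
  show "x < y \<longleftrightarrow> x \<le> y \<and> \<not> y \<le> x"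
    by (rule less_odiff_def)
  show "x \<le> z" if "x \<le> y" "y \<le> z"
  proof -
    have "(a + d) + (c + f) \<le> (b + c) + (d + e)"
      using that by (intro add_mono[of "a + d"]) (simp_all add: odiff_le_iff)
    then have "(a + f) + (c + d) \<le> (b + e) + (c + d)"
      by (simp only: ac_simps)
    then show ?thesis
      by (simp add: odiff_le_iff)
  qed
  show "x \<le> y \<Longrightarrow> y \<le> x \<Longrightarrow> x = y"
    by (simp add: odiff_le_iff odiff_eq_iff add.commute order.antisym)
  show "x \<le> y \<or> y \<le> x"
    by (simp add: odiff_le_iff add.commute linear)
  show "z + x \<le> z + y" if "x \<le> y"
  proof -
    have "(e + f) + (a + d) \<le> (e + f) + (b + c)"
      using that by (simp add: odiff_le_iff)
    then show ?thesis
      by (simp add: odiff_arith odiff_le_iff ac_simps)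
  qed
  show "z * x < z * y" if "x < y" "0 < z"
  proof -
    have "f < e" "a + d < b + c"
      using that by (simp_all add: odiff_less_iff odiff_arith)
    \<comment> \<open>Strict monotonicity of multiplication on differences is exactly the exchange
      inequality of the natural product.\<close>
    then have "f * (b + c) + e * (a + d) < e * (b + c) + f * (a + d)"
      by (rule ordinal_mult_exchange_strict)
    then show ?thesis
      by (simp add: odiff_arith odiff_less_iff algebra_simps)
  qed
  show "\<bar>x\<bar> = (if x < 0 then - x else x)"
    by (rule abs_odiff_def)
  show "sgn x = (if x = 0 then 0 else if 0 < x then 1 else - 1)"
    by (rule sgn_odiff_def)
qed

end


section \<open>The ring and the field of the paper inside the field of fractions\<close>

definition ZR :: "'a ordinal \<Rightarrow> 'a odiff set" where
  "ZR \<alpha> = {odiff a b | a b. a \<in> NN \<alpha> \<and> b \<in> NN \<alpha>}"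

text \<open>The isomorphism from \<open>ZR \<alpha>\<close> onto \<open>ZZ \<alpha>\<close>: a class
  of pairs in the whole ordinals is cut down to its members in \<open>NN \<alpha>\<close>. Outside
  \<open>ZR \<alpha>\<close> it is empty, so \<open>zcls_inj\<close> asks for membership of one
  argument only.\<close>

definition zcls :: "'a ordinal \<Rightarrow> 'a odiff \<Rightarrow> 'a zz" where
  "zcls \<alpha> x = {(a, b). a \<in> NN \<alpha> \<and> b \<in> NN \<alpha> \<and> odiff a b = x}"

lemma odiff_in_ZR: "a \<in> NN \<alpha> \<Longrightarrow> b \<in> NN \<alpha> \<Longrightarrow> odiff a b \<in> ZR \<alpha>"
  by (auto simp: ZR_def)

lemma ZR_cases:
  assumes "x \<in> ZR \<alpha>"
  obtains a b where "x = odiff a b" "a \<in> NN \<alpha>" "b \<in> NN \<alpha>"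
  using assms by (auto simp: ZR_def)

lemma ZR_intros:
  "0 \<in> ZR \<alpha>" "1 \<in> ZR \<alpha>"
  "x \<in> ZR \<alpha> \<Longrightarrow> - x \<in> ZR \<alpha>"
  "x \<in> ZR \<alpha> \<Longrightarrow> y \<in> ZR \<alpha> \<Longrightarrow> x + y \<in> ZR \<alpha>"
  "x \<in> ZR \<alpha> \<Longrightarrow> y \<in> ZR \<alpha> \<Longrightarrow> x * y \<in> ZR \<alpha>"
proof -
  show "0 \<in> ZR \<alpha>" "1 \<in> ZR \<alpha>"
    unfolding odiff_arith by (rule odiff_in_ZR; simp add: NN_zero NN_one)+
  show "- x \<in> ZR \<alpha>" if "x \<in> ZR \<alpha>"
    using that by (auto elim!: ZR_cases simp: odiff_arith odiff_in_ZR)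
  show "x + y \<in> ZR \<alpha>" "x * y \<in> ZR \<alpha>" if "x \<in> ZR \<alpha>" "y \<in> ZR \<alpha>"
    using that by (auto elim!: ZR_cases simp: odiff_arith odiff_in_ZR NN_add NN_mult)
qed

lemma zcls_memI: "a \<in> NN \<alpha> \<Longrightarrow> b \<in> NN \<alpha> \<Longrightarrow> (a, b) \<in> zcls \<alpha> (odiff a b)"
  by (simp add: zcls_def)

lemma zcls_cases:
  assumes "X \<in> zcls \<alpha> x"
  obtains a b where "X = (a, b)" "x = odiff a b" "a \<in> NN \<alpha>" "b \<in> NN \<alpha>"
  using assms by (auto simp: zcls_def)

lemma zcls_nonempty: "x \<in> ZR \<alpha> \<Longrightarrow> zcls \<alpha> x \<noteq> {}"
  by (auto simp: ZR_def dest: zcls_memI)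

lemma zcls_inj: "x \<in> ZR \<alpha> \<Longrightarrow> zcls \<alpha> x = zcls \<alpha> y \<longleftrightarrow> x = y"
  by (auto simp: zcls_def ZR_def set_eq_iff)

lemma ZZ_class_eq: "a \<in> NN \<alpha> \<Longrightarrow> b \<in> NN \<alpha> \<Longrightarrow> ZZ_class \<alpha> a b = zcls \<alpha> (odiff a b)"
  by (auto simp: ZZ_class_def ZZ_rel_def zcls_def ordinal_folds odiff_eq_iff add.commute)

lemma ZZ_eq: "ZZ \<alpha> = zcls \<alpha> ` ZR \<alpha>"
proof -
  have "ZZ \<alpha> = (\<lambda>(a, b). ZZ_class \<alpha> a b) ` (NN \<alpha> \<times> NN \<alpha>)"
    by (auto simp: ZZ_def quotient_def ZZ_class_def)
  also have "\<dots> = (\<lambda>(a, b). zcls \<alpha> (odiff a b)) ` (NN \<alpha> \<times> NN \<alpha>)"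
    by (rule image_cong) (auto simp: ZZ_class_eq)
  also have "\<dots> = zcls \<alpha> ` ZR \<alpha>"
    by (auto simp: ZR_def)
  finally show ?thesis .
qed

lemma ZZ_zero_eq: "ZZ_zero \<alpha> = zcls \<alpha> 0"
  by (simp add: ZZ_zero_def ordinal_folds ZZ_class_eq NN_zero odiff_arith)

lemma ZZ_one_eq: "ZZ_one \<alpha> = zcls \<alpha> 1"
  by (simp add: ZZ_one_def ordinal_folds ZZ_class_eq NN_zero NN_one odiff_arith)

text \<open>The quotient operations are unions over all representatives; this reduces each of them
  to independence of the representative.\<close>

lemma UN_const_eq: "X \<noteq> {} \<Longrightarrow> (\<And>x. x \<in> X \<Longrightarrow> f x = c) \<Longrightarrow> (\<Union>x\<in>X. f x) = c"
  by auto

lemma ZZ_add_eq: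
  assumes "x \<in> ZR \<alpha>" "y \<in> ZR \<alpha>"
  shows "ZZ_add \<alpha> (zcls \<alpha> x) (zcls \<alpha> y) = zcls \<alpha> (x + y)"
  unfolding ZZ_add_def ordinal_folds
proof (intro UN_const_eq zcls_nonempty assms)
  fix X assume "X \<in> zcls \<alpha> x"
  then obtain a b where X: "X = (a, b)" and ab: "x = odiff a b" "a \<in> NN \<alpha>" "b \<in> NN \<alpha>"
    by (rule zcls_cases)
  have "(\<Union>(c, d)\<in>zcls \<alpha> y. ZZ_class \<alpha> (a + c) (b + d)) = zcls \<alpha> (x + y)"
  proof (intro UN_const_eq zcls_nonempty assms)
    fix Y assume "Y \<in> zcls \<alpha> y"
    then obtain c d where Y: "Y = (c, d)" and cd: "y = odiff c d" "c \<in> NN \<alpha>" "d \<in> NN \<alpha>"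
      by (rule zcls_cases)
    show "(case Y of (c, d) \<Rightarrow> ZZ_class \<alpha> (a + c) (b + d)) = zcls \<alpha> (x + y)"
      unfolding Y ab(1) cd(1) using ab cd by (simp add: ZZ_class_eq NN_add odiff_arith)
  qed
  then show "(case X of (a, b) \<Rightarrow> \<Union>(c, d)\<in>zcls \<alpha> y. ZZ_class \<alpha> (a + c) (b + d)) = zcls \<alpha> (x + y)"
    by (simp add: X)
qed

lemma ZZ_mult_eq:
  assumes "x \<in> ZR \<alpha>" "y \<in> ZR \<alpha>"
  shows "ZZ_mult \<alpha> (zcls \<alpha> x) (zcls \<alpha> y) = zcls \<alpha> (x * y)"
  unfolding ZZ_mult_def ordinal_folds
proof (intro UN_const_eq zcls_nonempty assms)
  fix X assume "X \<in> zcls \<alpha> x"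
  then obtain a b where X: "X = (a, b)" and ab: "x = odiff a b" "a \<in> NN \<alpha>" "b \<in> NN \<alpha>"
    by (rule zcls_cases)
  have "(\<Union>(c, d)\<in>zcls \<alpha> y. ZZ_class \<alpha> (a * c + b * d) (a * d + b * c)) = zcls \<alpha> (x * y)"
  proof (intro UN_const_eq zcls_nonempty assms)
    fix Y assume "Y \<in> zcls \<alpha> y"
    then obtain c d where Y: "Y = (c, d)" and cd: "y = odiff c d" "c \<in> NN \<alpha>" "d \<in> NN \<alpha>"
      by (rule zcls_cases)
    show "(case Y of (c, d) \<Rightarrow> ZZ_class \<alpha> (a * c + b * d) (a * d + b * c)) = zcls \<alpha> (x * y)"
      unfolding Y ab(1) cd(1) using ab cd by (simp add: ZZ_class_eq NN_add NN_mult odiff_arith)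
  qed
  then show "(case X of (a, b) \<Rightarrow> \<Union>(c, d)\<in>zcls \<alpha> y. ZZ_class \<alpha> (a * c + b * d) (a * d + b * c)) = zcls \<alpha> (x * y)"
    by (simp add: X)
qed

lemma ZZ_uminus_eq:
  assumes "x \<in> ZR \<alpha>"
  shows "ZZ_uminus \<alpha> (zcls \<alpha> x) = zcls \<alpha> (- x)"
  unfolding ZZ_uminus_def
  using assms by (intro UN_const_eq zcls_nonempty) (auto simp: zcls_def ZZ_class_eq odiff_arith)

text \<open>\<open>ZZ_le\<close> asks for some representatives, but the comparison has the same
  outcome for all of them, and both classes are nonempty.\<close>

lemma ZZ_le_iff:
  assumes "x \<in> ZR \<alpha>" "y \<in> ZR \<alpha>"
  shows "ZZ_le (zcls \<alpha> x) (zcls \<alpha> y) \<longleftrightarrow> x \<le> y"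
proof -
  obtain a b c d where abcd: "(a, b) \<in> zcls \<alpha> x" "(c, d) \<in> zcls \<alpha> y"
    using assms zcls_nonempty by (metis ex_in_conv surj_pair)
  have *: "d' + a' \<le> c' + b' \<longleftrightarrow> x \<le> y"
    if "(a', b') \<in> zcls \<alpha> x" "(c', d') \<in> zcls \<alpha> y" for a' b' c' d'
    using that by (auto simp: zcls_def odiff_le_iff add.commute)
  show ?thesis
    unfolding ZZ_le_def ordinal_folds using * abcd by blast
qed

section \<open>The field of fractions and its carrier\<close>

definition QR :: "'a ordinal \<Rightarrow> 'a odiff fract set" where
  "QR \<alpha> = {Fract x y | x y. x \<in> ZR \<alpha> \<and> y \<in> ZR \<alpha> \<and> y \<noteq> 0}"

definition qcls :: "'a ordinal \<Rightarrow> 'a odiff fract \<Rightarrow> 'a qq" where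
  "qcls \<alpha> q =
    {(zcls \<alpha> x, zcls \<alpha> y) | x y. x \<in> ZR \<alpha> \<and> y \<in> ZR \<alpha> \<and> y \<noteq> 0 \<and> Fract x y = q}"

text \<open>Halving is there for midpoints, with which the suprema and infima of balls are
  determined.\<close>

lemma
  shows QR_zero: "0 \<in> QR \<alpha>"
    and QR_uminus: "p \<in> QR \<alpha> \<Longrightarrow> - p \<in> QR \<alpha>"
    and QR_add: "p \<in> QR \<alpha> \<Longrightarrow> q \<in> QR \<alpha> \<Longrightarrow> p + q \<in> QR \<alpha>"
    and QR_half: "p \<in> QR \<alpha> \<Longrightarrow> p / 2 \<in> QR \<alpha>"
proof -
  show "0 \<in> QR \<alpha>"
    unfolding QR_def Zero_fract_def mem_Collect_eq
    by (intro exI conjI, rule refl, simp_all add: ZR_intros)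
  show "- p \<in> QR \<alpha>" if p: "p \<in> QR \<alpha>"
  proof -
    from p obtain x y where "p = Fract x y" "x \<in> ZR \<alpha>" "y \<in> ZR \<alpha>" "y \<noteq> 0"
      by (auto simp: QR_def)
    then have "- p = Fract (- x) y" "- x \<in> ZR \<alpha>"
      by (simp_all add: ZR_intros)
    with \<open>y \<in> ZR \<alpha>\<close> \<open>y \<noteq> 0\<close> show ?thesis
      by (auto simp: QR_def)
  qed
  show "p + q \<in> QR \<alpha>" if p: "p \<in> QR \<alpha>" and q: "q \<in> QR \<alpha>"
  proof -
    from p q obtain x y u v where xy: "p = Fract x y" "x \<in> ZR \<alpha>" "y \<in> ZR \<alpha>" "y \<noteq> 0"
      and uv: "q = Fract u v" "u \<in> ZR \<alpha>" "v \<in> ZR \<alpha>" "v \<noteq> 0"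
      by (auto simp: QR_def)
    then have "p + q = Fract (x * v + u * y) (y * v)"
      by simp
    moreover have "x * v + u * y \<in> ZR \<alpha>" "y * v \<in> ZR \<alpha>" "y * v \<noteq> 0"
      using xy uv by (simp_all add: ZR_intros)
    ultimately show ?thesis
      unfolding QR_def by blast
  qed
  show "p / 2 \<in> QR \<alpha>" if p: "p \<in> QR \<alpha>"
  proof -
    from p obtain x y where xy: "p = Fract x y" "x \<in> ZR \<alpha>" "y \<in> ZR \<alpha>" "y \<noteq> 0"
      by (auto simp: QR_def)
    \<comment> \<open>Written as \<open>1 + 1\<close> so that membership of the new denominator in
      \<open>ZR \<alpha>\<close> follows from closure under sums and products.\<close>
    have two: "(2 :: 'a odiff fract) = Fract (1 + 1) 1"
      using add_fract[of 1 1 1 "1 :: 'a odiff"] by (simp flip: One_fract_def)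
    have "p / 2 = Fract x (y * (1 + 1))"
      by (simp only: xy(1) two divide_fract mult_1_right)
    moreover have "y * (1 + 1) \<in> ZR \<alpha>"
      using xy by (intro ZR_intros)
    moreover have "y * (1 + 1) \<noteq> 0"
      using xy by simp
    ultimately show ?thesis
      using xy unfolding QR_def by blast
  qed
qed

lemma QR_diff: "p \<in> QR \<alpha> \<Longrightarrow> q \<in> QR \<alpha> \<Longrightarrow> p - q \<in> QR \<alpha>"
  using QR_add[of p \<alpha> "- q", OF _ QR_uminus] by simp

lemma qcls_memI:
  "x \<in> ZR \<alpha> \<Longrightarrow> y \<in> ZR \<alpha> \<Longrightarrow> y \<noteq> 0 \<Longrightarrow> (zcls \<alpha> x, zcls \<alpha> y) \<in> qcls \<alpha> (Fract x y)"
  by (auto simp: qcls_def)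

lemma qcls_nonempty: "p \<in> QR \<alpha> \<Longrightarrow> qcls \<alpha> p \<noteq> {}"
  unfolding QR_def using qcls_memI by blast

lemma qcls_memD:
  assumes "(zcls \<alpha> x, zcls \<alpha> y) \<in> qcls \<alpha> p" "x \<in> ZR \<alpha>" "y \<in> ZR \<alpha>"
  shows "y \<noteq> 0" "Fract x y = p"
  using assms by (auto simp: qcls_def zcls_inj)

lemma qcls_inj:
  assumes "p \<in> QR \<alpha>"
  shows "qcls \<alpha> p = qcls \<alpha> q \<longleftrightarrow> p = q"
proof
  assume eq: "qcls \<alpha> p = qcls \<alpha> q"
  from assms obtain x y where xy: "x \<in> ZR \<alpha>" "y \<in> ZR \<alpha>" "y \<noteq> 0" "p = Fract x y"
    by (auto simp: QR_def)
  then have "(zcls \<alpha> x, zcls \<alpha> y) \<in> qcls \<alpha> q"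
    using eq qcls_memI by blast
  with xy show "p = q"
    by (simp add: qcls_memD)
qed simp

lemma QQ_class_eq:
  assumes "x \<in> ZR \<alpha>" "y \<in> ZR \<alpha>" "y \<noteq> 0"
  shows "QQ_class \<alpha> (zcls \<alpha> x) (zcls \<alpha> y) = qcls \<alpha> (Fract x y)"
proof -
  have "(X, Y) \<in> QQ_class \<alpha> (zcls \<alpha> x) (zcls \<alpha> y) \<longleftrightarrow> (X, Y) \<in> qcls \<alpha> (Fract x y)" for X Y
  \<comment> \<open>Pairs not made of classes of \<open>ZR \<alpha>\<close> belong to neither side;
    for the others the relation becomes equality of fractions.\<close>
  proof (cases "\<exists>u\<in>ZR \<alpha>. \<exists>v\<in>ZR \<alpha>. X = zcls \<alpha> u \<and> Y = zcls \<alpha> v")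
    case True
    then obtain u v where uv: "u \<in> ZR \<alpha>" "v \<in> ZR \<alpha>" and [simp]: "X = zcls \<alpha> u" "Y = zcls \<alpha> v"
      by blast
    have "(X, Y) \<in> QQ_class \<alpha> (zcls \<alpha> x) (zcls \<alpha> y) \<longleftrightarrow> v \<noteq> 0 \<and> x * v = y * u"
      using assms uv
      by (simp add: QQ_class_def QQ_rel_def ZZ_eq ZZ_zero_eq zcls_inj ZZ_mult_eq ZR_intros)
    also have "\<dots> \<longleftrightarrow> v \<noteq> 0 \<and> Fract u v = Fract x y"
      using assms by (auto simp: eq_fract mult.commute)
    also have "\<dots> \<longleftrightarrow> (X, Y) \<in> qcls \<alpha> (Fract x y)"
      using uv by (auto simp: qcls_def zcls_inj)
    finally show ?thesis .
  next
    case False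
    then show ?thesis
      by (auto simp: QQ_class_def QQ_rel_def ZZ_eq qcls_def)
  qed
  then show ?thesis
    by auto
qed

lemma QQ_eq: "QQ \<alpha> = qcls \<alpha> ` QR \<alpha>"
proof -
  have nonzero: "ZZ \<alpha> - {ZZ_zero \<alpha>} = zcls \<alpha> ` (ZR \<alpha> - {0})"
    by (auto simp: ZZ_eq ZZ_zero_eq zcls_inj)
  have "QQ \<alpha> = (\<lambda>(X, Y). QQ_class \<alpha> X Y) ` (zcls \<alpha> ` ZR \<alpha> \<times> zcls \<alpha> ` (ZR \<alpha> - {0}))"
    unfolding QQ_def quotient_def nonzero
    unfolding ZZ_eq UNION_singleton_eq_range QQ_class_def case_prod_beta prod.collapse by (rule refl)
  also have "\<dots> = (\<lambda>(x, y). QQ_class \<alpha> (zcls \<alpha> x) (zcls \<alpha> y)) ` (ZR \<alpha> \<times> (ZR \<alpha> - {0}))"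
    by (simp only: image_paired_Times[symmetric] image_image split_def fst_conv snd_conv)
  also have "\<dots> = (\<lambda>(x, y). qcls \<alpha> (Fract x y)) ` (ZR \<alpha> \<times> (ZR \<alpha> - {0}))"
    by (rule image_cong) (auto simp: QQ_class_eq)
  also have "\<dots> = qcls \<alpha> ` QR \<alpha>"
    by (auto simp: QR_def)
  finally show ?thesis .
qed

lemma QQ_zero_eq: "QQ_zero \<alpha> = qcls \<alpha> 0"
  by (simp add: QQ_zero_def ZZ_zero_eq ZZ_one_eq QQ_class_eq ZR_intros Zero_fract_def)

lemma qcls_cases:
  assumes "X \<in> qcls \<alpha> p"
  obtains x y where "X = (zcls \<alpha> x, zcls \<alpha> y)" "x \<in> ZR \<alpha>" "y \<in> ZR \<alpha>" "y \<noteq> 0" "Fract x y = p"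
  using assms by (auto simp: qcls_def)

lemma QQ_add_eq:
  assumes "p \<in> QR \<alpha>" "q \<in> QR \<alpha>"
  shows "QQ_add \<alpha> (qcls \<alpha> p) (qcls \<alpha> q) = qcls \<alpha> (p + q)"
  unfolding QQ_add_def
proof (intro UN_const_eq qcls_nonempty assms)
  fix X assume "X \<in> qcls \<alpha> p"
  then obtain x y where X: "X = (zcls \<alpha> x, zcls \<alpha> y)" and
    xy: "x \<in> ZR \<alpha>" "y \<in> ZR \<alpha>" "y \<noteq> 0" "Fract x y = p"
    by (rule qcls_cases)
  have "(\<Union>(c, d)\<in>qcls \<alpha> q. QQ_class \<alpha>
    (ZZ_add \<alpha> (ZZ_mult \<alpha> (zcls \<alpha> x) d) (ZZ_mult \<alpha> (zcls \<alpha> y) c)) (ZZ_mult \<alpha> (zcls \<alpha> y) d))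
    = qcls \<alpha> (p + q)"
  proof (intro UN_const_eq qcls_nonempty assms)
    fix Y assume "Y \<in> qcls \<alpha> q"
    then obtain u v where Y: "Y = (zcls \<alpha> u, zcls \<alpha> v)" and
      uv: "u \<in> ZR \<alpha>" "v \<in> ZR \<alpha>" "v \<noteq> 0" "Fract u v = q"
      by (rule qcls_cases)
    have "p + q = Fract (x * v + y * u) (y * v)"
      using add_fract[OF xy(3) uv(3), of x u] by (simp add: xy uv mult.commute)
    then show "(case Y of (c, d) \<Rightarrow> QQ_class \<alpha>
      (ZZ_add \<alpha> (ZZ_mult \<alpha> (zcls \<alpha> x) d) (ZZ_mult \<alpha> (zcls \<alpha> y) c)) (ZZ_mult \<alpha> (zcls \<alpha> y) d))
      = qcls \<alpha> (p + q)"
      using xy uv by (simp add: Y ZZ_mult_eq ZZ_add_eq ZR_intros QQ_class_eq)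
  qed
  then show "(case X of (a, b) \<Rightarrow> \<Union>(c, d)\<in>qcls \<alpha> q. QQ_class \<alpha>
    (ZZ_add \<alpha> (ZZ_mult \<alpha> a d) (ZZ_mult \<alpha> b c)) (ZZ_mult \<alpha> b d)) = qcls \<alpha> (p + q)"
    by (simp add: X)
qed

lemma QQ_uminus_eq:
  assumes "p \<in> QR \<alpha>"
  shows "QQ_uminus \<alpha> (qcls \<alpha> p) = qcls \<alpha> (- p)"
  unfolding QQ_uminus_def
proof (intro UN_const_eq qcls_nonempty assms)
  fix X assume "X \<in> qcls \<alpha> p"
  then obtain x y where X: "X = (zcls \<alpha> x, zcls \<alpha> y)" and
    xy: "x \<in> ZR \<alpha>" "y \<in> ZR \<alpha>" "y \<noteq> 0" "Fract x y = p"
    by (rule qcls_cases)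
  then have "- p = Fract (- x) y"
    by auto
  with xy show "(case X of (a, b) \<Rightarrow> QQ_class \<alpha> (ZZ_uminus \<alpha> a) b) = qcls \<alpha> (- p)"
    by (simp add: X ZZ_uminus_eq QQ_class_eq ZR_intros)
qed

lemma QQ_minus_eq:
  "p \<in> QR \<alpha> \<Longrightarrow> q \<in> QR \<alpha> \<Longrightarrow> QQ_minus \<alpha> (qcls \<alpha> p) (qcls \<alpha> q) = qcls \<alpha> (p - q)"
  by (simp add: QQ_minus_def QQ_uminus_eq QQ_add_eq QR_uminus)

lemma QQ_nonneg_iff:
  assumes "p \<in> QR \<alpha>"
  shows "QQ_nonneg \<alpha> (qcls \<alpha> p) \<longleftrightarrow> 0 \<le> p"
proof -
  have *: "(case X of (a, b) \<Rightarrow> ZZ_le (ZZ_zero \<alpha>) (ZZ_mult \<alpha> a b)) \<longleftrightarrow> 0 \<le> p" if "X \<in> qcls \<alpha> p" for X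
    using that
  proof (rule qcls_cases)
    fix x y
    assume X: "X = (zcls \<alpha> x, zcls \<alpha> y)" and
      xy: "x \<in> ZR \<alpha>" "y \<in> ZR \<alpha>" "y \<noteq> 0" "Fract x y = p"
    have "0 \<le> p \<longleftrightarrow> 0 \<le> x * y"
      unfolding xy(4)[symmetric] Zero_fract_def using xy(3) by simp
    with xy show ?thesis
      by (simp add: X ZZ_zero_eq ZZ_mult_eq ZZ_le_iff ZR_intros)
  qed
  show ?thesis
    unfolding QQ_nonneg_def using * qcls_nonempty[OF assms] by blast
qed

lemma QQ_le_iff: "p \<in> QR \<alpha> \<Longrightarrow> q \<in> QR \<alpha> \<Longrightarrow> QQ_le \<alpha> (qcls \<alpha> p) (qcls \<alpha> q) \<longleftrightarrow> p \<le> q"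
  by (simp add: QQ_le_def QQ_minus_eq QQ_nonneg_iff QR_diff)

lemma QQ_less_iff: "p \<in> QR \<alpha> \<Longrightarrow> q \<in> QR \<alpha> \<Longrightarrow> QQ_less \<alpha> (qcls \<alpha> p) (qcls \<alpha> q) \<longleftrightarrow> p < q"
  by (auto simp: QQ_less_def QQ_le_iff qcls_inj)

lemma QQ_pos_eq: "QQ_pos \<alpha> = qcls \<alpha> ` {p \<in> QR \<alpha>. 0 < p}"
  by (auto simp: QQ_pos_def QQ_eq QQ_zero_eq QQ_less_iff QR_zero)

lemma QR_abs: "p \<in> QR \<alpha> \<Longrightarrow> \<bar>p\<bar> \<in> QR \<alpha>"
  by (simp add: abs_if QR_uminus)

lemma QQ_abs_eq: "p \<in> QR \<alpha> \<Longrightarrow> QQ_abs \<alpha> (qcls \<alpha> p) = qcls \<alpha> \<bar>p\<bar>"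
  by (simp add: QQ_abs_def QQ_zero_eq QQ_le_iff QR_zero QQ_uminus_eq)

section \<open>Balls and what properness says about them\<close>

lemma QQ_ball_eq:
  "x \<in> QR \<alpha> \<Longrightarrow> r \<in> QR \<alpha> \<Longrightarrow>
    QQ_ball \<alpha> (qcls \<alpha> x) (qcls \<alpha> r) = qcls \<alpha> ` {y \<in> QR \<alpha>. \<bar>x - y\<bar> < r}"
  by (auto simp: QQ_ball_def QQ_eq QQ_minus_eq QQ_abs_eq QQ_less_iff QR_diff QR_abs)

lemma is_sup_ball:
  assumes x: "x \<in> QR \<alpha>" and r: "r \<in> QR \<alpha>" "0 < r"
  shows "is_sup \<alpha> (QQ_ball \<alpha> (qcls \<alpha> x) (qcls \<alpha> r)) (qcls \<alpha> (x + r))"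
proof -
  have "x + r \<le> u" if u: "u \<in> QR \<alpha>" and le: "\<And>y. y \<in> QR \<alpha> \<Longrightarrow> \<bar>x - y\<bar> < r \<Longrightarrow> y \<le> u" for u
  proof (rule ccontr)
    assume "\<not> x + r \<le> u"
    moreover have "x \<le> u"
      using le[of x] x r by simp
    \<comment> \<open>As \<open>x \<le> u < x + r\<close>, the midpoint of \<open>u\<close> and
      \<open>x + r\<close> is still in the ball but exceeds the alleged bound
      \<open>u\<close>.\<close>
    ultimately have "\<bar>x - (u + (x + r)) / 2\<bar> < r" "\<not> (u + (x + r)) / 2 \<le> u"
      by (auto simp: abs_less_iff field_simps)
    moreover have "(u + (x + r)) / 2 \<in> QR \<alpha>"
      using u x r by (intro QR_half QR_add)
    ultimately show False
      using le by blast
  qed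
  with x r show ?thesis
    by (auto simp: is_sup_def QQ_ball_eq QQ_eq QQ_le_iff QR_add abs_less_iff)
qed

lemma is_inf_ball:
  assumes x: "x \<in> QR \<alpha>" and r: "r \<in> QR \<alpha>" "0 < r"
  shows "is_inf \<alpha> (QQ_ball \<alpha> (qcls \<alpha> x) (qcls \<alpha> r)) (qcls \<alpha> (x - r))"
proof -
  have "u \<le> x - r" if u: "u \<in> QR \<alpha>" and le: "\<And>y. y \<in> QR \<alpha> \<Longrightarrow> \<bar>x - y\<bar> < r \<Longrightarrow> u \<le> y" for u
  proof (rule ccontr)
    assume "\<not> u \<le> x - r"
    moreover have "u \<le> x"
      using le[of x] x r by simp
    ultimately have "\<bar>x - (u + (x - r)) / 2\<bar> < r" "\<not> u \<le> (u + (x - r)) / 2"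
      by (auto simp: abs_less_iff field_simps)
    moreover have "(u + (x - r)) / 2 \<in> QR \<alpha>"
      using u x r by (intro QR_half QR_add QR_diff)
    ultimately show False
      using le by blast
  qed
  with x r show ?thesis
    by (auto simp: is_inf_def QQ_ball_eq QQ_eq QQ_le_iff QR_diff abs_less_iff)
qed

text \<open>Properness gives a ball meeting both sides whose diameter \<open>r + r\<close> does not
  exceed \<open>d\<close>. The ball is open, so two of its points differ by strictly less than the
  diameter, which makes the final bound strict.\<close>

lemma proper_cut_close:
  assumes AB: "A \<subseteq> QR \<alpha>" "B \<subseteq> QR \<alpha>"
    and proper: "\<not> improper_cut \<alpha> (qcls \<alpha> ` A, qcls \<alpha> ` B)"
    and d: "d \<in> QR \<alpha>" "0 < d"
  shows "\<exists>a\<in>A. \<exists>b\<in>B. b - a < d"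
proof -
  have "qcls \<alpha> d \<in> QQ_pos \<alpha>"
    using d by (auto simp: QQ_pos_eq)
  moreover have "\<forall>d\<in>QQ_pos \<alpha>. \<exists>U\<in>QQ_balls \<alpha>. U \<inter> qcls \<alpha> ` A \<noteq> {} \<and> U \<inter> qcls \<alpha> ` B \<noteq> {} \<and>
      (\<forall>s. is_sup \<alpha> U s \<longrightarrow> (\<forall>i. is_inf \<alpha> U i \<longrightarrow> \<not> QQ_less \<alpha> d (QQ_minus \<alpha> s i)))"
    using proper by (simp add: improper_cut_def)
  ultimately have "\<exists>U\<in>QQ_balls \<alpha>. U \<inter> qcls \<alpha> ` A \<noteq> {} \<and> U \<inter> qcls \<alpha> ` B \<noteq> {} \<and>
      (\<forall>s. is_sup \<alpha> U s \<longrightarrow> (\<forall>i. is_inf \<alpha> U i \<longrightarrow>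
        \<not> QQ_less \<alpha> (qcls \<alpha> d) (QQ_minus \<alpha> s i)))"
    by (rule bspec[rotated])
  then obtain U where "U \<in> QQ_balls \<alpha>" and UA: "U \<inter> qcls \<alpha> ` A \<noteq> {}"
    and UB: "U \<inter> qcls \<alpha> ` B \<noteq> {}"
    and U: "\<forall>s. is_sup \<alpha> U s \<longrightarrow> (\<forall>i. is_inf \<alpha> U i \<longrightarrow>
        \<not> QQ_less \<alpha> (qcls \<alpha> d) (QQ_minus \<alpha> s i))"
    by blast
  then obtain x r where xr: "x \<in> QR \<alpha>" "r \<in> QR \<alpha>" "0 < r"
    and U_eq: "U = QQ_ball \<alpha> (qcls \<alpha> x) (qcls \<alpha> r)"
    by (auto simp: QQ_balls_def QQ_eq QQ_pos_eq)
  \<comment> \<open>The negated condition constrains only suprema and infima that exist, so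
    \<open>x + r\<close> and \<open>x - r\<close> have to be exhibited as such.\<close>
  have "\<not> QQ_less \<alpha> (qcls \<alpha> d) (qcls \<alpha> ((x + r) - (x - r)))"
    using U[unfolded U_eq, rule_format, OF is_sup_ball[OF xr] is_inf_ball[OF xr]] xr
    by (simp only: QQ_minus_eq QR_add QR_diff not_False_eq_True)
  then have "\<not> d < (x + r) - (x - r)"
    using QQ_less_iff[OF d(1) QR_diff[OF QR_add QR_diff]] xr by blast
  then have "r + r \<le> d"
    by simp
  obtain a where a: "a \<in> A" "\<bar>x - a\<bar> < r"
    using UA AB xr by (auto simp: U_eq QQ_ball_eq) (metis qcls_inj subsetD)
  obtain b where b: "b \<in> B" "\<bar>x - b\<bar> < r"
    using UB AB xr by (auto simp: U_eq QQ_ball_eq) (metis qcls_inj subsetD)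
  have "b - a < r + r"
    using a b by (simp add: abs_less_iff)
  also have "\<dots> \<le> d"
    by fact
  finally show ?thesis
    using a b by blast
qed

text \<open>
  Translate a close pair \<open>a0 < b0\<close> to one at distance exactly \<open>d\<close>, keeping either \<open>b0\<close> or \<open>a0\<close>
  fixed; at least one of the two new points avoids the possible gap of the cut.
\<close>

lemma cut_exact_distance:
  fixes K :: "'k :: linordered_field set"
  assumes K: "\<And>p q. p \<in> K \<Longrightarrow> q \<in> K \<Longrightarrow> p + q \<in> K" "\<And>p q. p \<in> K \<Longrightarrow> q \<in> K \<Longrightarrow> p - q \<in> K"
    and AB: "A \<subseteq> K" "B \<subseteq> K" "\<And>a b. a \<in> A \<Longrightarrow> b \<in> B \<Longrightarrow> a < b"
    and gap: "\<And>p q. p \<in> K - (A \<union> B) \<Longrightarrow> q \<in> K - (A \<union> B) \<Longrightarrow> p = q"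
    and close: "\<exists>a\<in>A. \<exists>b\<in>B. b - a < d"
    and d: "d \<in> K" "0 < d"
  shows "\<exists>a\<in>A. \<exists>b\<in>B. b - a = d"
proof -
  obtain a0 b0 where ab: "a0 \<in> A" "b0 \<in> B" "b0 - a0 < d"
    using close by blast
  have in_K: "b0 - d \<in> K" "a0 + d \<in> K"
    using ab AB K d by blast+
  have "b0 - d < a0" "b0 < a0 + d"
    using ab by (simp_all add: algebra_simps)
  \<comment> \<open>From \<open>b0 - d < a0 < b0 < a0 + d\<close>: neither new point can lie on the
    far side of the cut. If neither lay on its intended side either, the cut would miss two distinct
    points.\<close>
  then have "b0 - d \<notin> B" "a0 + d \<notin> A" "b0 - d \<noteq> a0 + d"
    using AB(3)[of a0 "b0 - d"] AB(3)[of "a0 + d" b0] AB(3)[of a0 b0] ab by force+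
  then have "b0 - d \<in> A \<or> a0 + d \<in> B"
    using gap in_K by blast
  then show ?thesis
    using ab by (metis add_diff_cancel_left' diff_diff_eq2 add_diff_cancel_right')
qed

theorem mainTheorem8:
  fixes \<alpha> :: "'a ordinal" and A B :: "'a qq set"
  assumes "(A, B) \<in> cuts \<alpha>" and "\<not> improper_cut \<alpha> (A, B)"
  shows "cut_add \<alpha> (A, B) (cut_uminus \<alpha> (A, B)) = cut_zero \<alpha>"
proof -
  have "A \<subseteq> qcls \<alpha> ` QR \<alpha>" "B \<subseteq> qcls \<alpha> ` QR \<alpha>"
    using assms(1) by (simp_all add: cuts_def QQ_eq)
  then obtain A' B' where A': "A' \<subseteq> QR \<alpha>" "A = qcls \<alpha> ` A'" and B': "B' \<subseteq> QR \<alpha>" "B = qcls \<alpha> ` B'"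
    by (auto simp: subset_image_iff)
  have mem: "qcls \<alpha> p \<in> qcls \<alpha> ` S \<longleftrightarrow> p \<in> S" if "p \<in> QR \<alpha>" for p S
    by (auto simp: image_iff qcls_inj[OF that])
  have less: "a < b" if "a \<in> A'" "b \<in> B'" for a b
  proof -
    have "\<forall>a\<in>A. \<forall>b\<in>B. QQ_less \<alpha> a b"
      using assms(1) by (simp add: cuts_def)
    then have "QQ_less \<alpha> (qcls \<alpha> a) (qcls \<alpha> b)"
      using that A' B' by simp
    then show ?thesis
      using that A' B' by (simp add: QQ_less_iff subset_iff)
  qed
  have gap: "p = q" if "p \<in> QR \<alpha> - (A' \<union> B')" "q \<in> QR \<alpha> - (A' \<union> B')" for p q
  proof -
    have "qcls \<alpha> p \<in> QQ \<alpha> - (A \<union> B)" "qcls \<alpha> q \<in> QQ \<alpha> - (A \<union> B)"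
      using that by (simp_all add: QQ_eq A' B' mem)
    then have "qcls \<alpha> p = qcls \<alpha> q"
      using assms(1) unfolding cuts_def by blast
    with that show ?thesis
      by (simp add: qcls_inj)
  qed
  have exact: "\<exists>a\<in>A'. \<exists>b\<in>B'. b - a = d" if d: "d \<in> QR \<alpha>" "0 < d" for d
    using proper_cut_close[OF A'(1) B'(1) _ d] assms(2)
    by (intro cut_exact_distance[of "QR \<alpha>"] QR_add QR_diff A' B' less gap d) (simp_all add: A' B')
  \<comment> \<open>Both components of the sum have this shape, with \<open>A'\<close> and
    \<open>B'\<close> for \<open>S\<close> and \<open>T\<close> in either order; what remains is a
    statement about differences in the ordered field.\<close>
  have sums: "minkowski_sum \<alpha> (qcls \<alpha> ` S) (QQ_uminus \<alpha> ` qcls \<alpha> ` T)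
      = qcls \<alpha> ` {s - t | s t. s \<in> S \<and> t \<in> T}" if "S \<subseteq> QR \<alpha>" "T \<subseteq> QR \<alpha>" for S T
  proof -
    have "minkowski_sum \<alpha> (qcls \<alpha> ` S) (QQ_uminus \<alpha> ` qcls \<alpha> ` T)
        = {QQ_minus \<alpha> (qcls \<alpha> s) (qcls \<alpha> t) | s t. s \<in> S \<and> t \<in> T}"
      by (auto simp: minkowski_sum_def QQ_minus_def)
    also have "\<dots> = {qcls \<alpha> (s - t) | s t. s \<in> S \<and> t \<in> T}"
      using that QQ_minus_eq by (metis (no_types, lifting) subsetD)
    finally show ?thesis
      by auto
  qed
  have "{a - b | a b. a \<in> A' \<and> b \<in> B'} = {q \<in> QR \<alpha>. q < 0}"
  proof (intro equalityI subsetI)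
    fix q assume "q \<in> {q \<in> QR \<alpha>. q < 0}"
    \<comment> \<open>The distance to realise is the positive element \<open>- q\<close>, so that
      \<open>a - b = q\<close>.\<close>
    then obtain a b where "a \<in> A'" "b \<in> B'" "b - a = - q"
      using exact[of "- q"] by (auto simp: QR_uminus)
    then show "q \<in> {a - b | a b. a \<in> A' \<and> b \<in> B'}"
      by (auto intro!: exI[of _ a] exI[of _ b] simp: algebra_simps)
  qed (use A' B' less in \<open>auto intro!: QR_diff\<close>)
  moreover have "{b - a | b a. b \<in> B' \<and> a \<in> A'} = {q \<in> QR \<alpha>. 0 < q}"
  proof (intro equalityI subsetI)
    fix q assume "q \<in> {q \<in> QR \<alpha>. 0 < q}"
    then show "q \<in> {b - a | b a. b \<in> B' \<and> a \<in> A'}"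
      using exact[of q] by auto
  qed (use A' B' less in \<open>auto intro!: QR_diff\<close>)
  moreover have "{q \<in> QQ \<alpha>. QQ_less \<alpha> q (QQ_zero \<alpha>)} = qcls \<alpha> ` {q \<in> QR \<alpha>. q < 0}"
    "{q \<in> QQ \<alpha>. QQ_less \<alpha> (QQ_zero \<alpha>) q} = qcls \<alpha> ` {q \<in> QR \<alpha>. 0 < q}"
    by (auto simp: QQ_eq QQ_zero_eq QQ_less_iff QR_zero)
  ultimately show ?thesis
    by (simp add: cut_add_def cut_uminus_def cut_zero_def A' B' sums)
qed

end
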